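(* Let $W$ be an irreducible $T$-module with endpoint $r$ and diameter $d=D-2r$. Pick nonzero vectors $u\in E_rW$, $u^*\in E^*_rW$, $u^{\varepsilon}\in E^{\varepsilon}_rW$, and consider the six bases of $W$ $$\mathcal{B}_1=(E^*_{r+i}u)_{i=0}^d,\quad \mathcal{B}_2=(E^{\varepsilon}_{r+i}u)_{i=0}^d,\quad \mathcal{B}_3=(E^{\varepsilon}_{r+i}u^* )_{i=0}^d,$$ $$\mathcal{B}_4=(E_{r+i}u^* )_{i=0}^d,\quad \mathcal{B}_5=(E_{r+i}u^{\varepsilon})_{i=0}^d,\quad \mathcal{B}_6=(E^*_{r+i}u^{\varepsilon})_{i=0}^d.$$ Let $C^{(k,l)}$ denote the transition matrix from $\mathcal{B}_k$ to $\mathcal{B}_l$. Then $C^{(k,k)}=\mathrm{diag}(1,1,\ldots,1)$ for $1\le k\le 6$, and, writing $[\,\cdot\,]$ for the matrix $[\,\cdot\,]_{i,j=0}^d$ with the indicated $(i,j)$-entry: From $\mathcal{B}_1$: $C^{(1,2)}=\frac{1}{(1-\mathbf{i})^d}[\mathbf{i}^{-i-j}\Phi_{ij}]$, $C^{(1,3)}=\frac{\langle u^*,u\rangle}{\|u\|^2}[\mathbf{i}^{-i}\Phi_{ij}]$, $C^{(1,4)}=\frac{\langle u^*,u\rangle}{\|u\|^2}[\Phi_{ij}]$, $C^{(1,5)}=\frac{\langle u^{\varepsilon},u\rangle}{\|u\|^2}[\mathbf{i}^{j}\Phi_{ij}]$, $C^{(1,6)}=\frac{(1+\mathbf{i})^d\langle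 u^{\varepsilon},u\rangle}{\|u\|^2}D_2$. From $\mathcal{B}_2$: $C^{(2,1)}=\frac{1}{(1+\mathbf{i})^d}[\mathbf{i}^{i+j}\Phi_{ij}]$, $C^{(2,3)}=\frac{(1-\mathbf{i})^d\langle u^*,u\rangle}{\|u\|^2}D_1$, $C^{(2,4)}=\frac{\langle u^*,u\rangle}{\|u\|^2}[\mathbf{i}^{-j}\Phi_{ij}]$, $C^{(2,5)}=\frac{\langle u^{\varepsilon},u\rangle}{\|u\|^2}[\Phi_{ij}]$, $C^{(2,6)}=\frac{\langle u^{\varepsilon},u\rangle}{\|u\|^2}[\mathbf{i}^{i}\Phi_{ij}]$. From $\mathcal{B}_3$: $C^{(3,1)}=\frac{\langle u,u^*\rangle}{\|u^*\|^2}[\mathbf{i}^{j}\Phi_{ij}]$, $C^{(3,2)}=\frac{(1+\mathbf{i})^d\langle u,u^*\rangle}{\|u^*\|^2}D_2$, $C^{(3,4)}=\frac{1}{(1-\mathbf{i})^d}[\mathbf{i}^{-i-j}\Phi_{ij}]$, $C^{(3,5)}=\frac{\langle u^{\varepsilon},u^*\rangle}{\|u^*\|^2}[\mathbf{i}^{-i}\Phi_{ij}]$, $C^{(3,6)}=\frac{\langle u^{\varepsilon},u^*\rangle}{\|u^*\|^2}[\Phi_{ij}]$. From $\mathcal{B}_4$: $C^{(4,1)}=\frac{\langle u,u^*\rangle}{\|u^*\|^2}[\Phi_{ij}]$, $C^{(4,2)}=\frac{\langle u,u^*\rangle}{\|u^*\|^2}[\mathbf{i}^{i}\Phi_{ij}]$,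 $C^{(4,3)}=\frac{1}{(1+\mathbf{i})^d}[\mathbf{i}^{i+j}\Phi_{ij}]$, $C^{(4,5)}=\frac{(1-\mathbf{i})^d\langle u^{\varepsilon},u^*\rangle}{\|u^*\|^2}D_1$, $C^{(4,6)}=\frac{\langle u^{\varepsilon},u^*\rangle}{\|u^*\|^2}[\mathbf{i}^{-j}\Phi_{ij}]$. From $\mathcal{B}_5$: $C^{(5,1)}=\frac{\langle u,u^{\varepsilon}\rangle}{\|u^{\varepsilon}\|^2}[\mathbf{i}^{-i}\Phi_{ij}]$, $C^{(5,2)}=\frac{\langle u,u^{\varepsilon}\rangle}{\|u^{\varepsilon}\|^2}[\Phi_{ij}]$, $C^{(5,3)}=\frac{\langle u^*,u^{\varepsilon}\rangle}{\|u^{\varepsilon}\|^2}[\mathbf{i}^{j}\Phi_{ij}]$, $C^{(5,4)}=\frac{(1+\mathbf{i})^d\langle u^*,u^{\varepsilon}\rangle}{\|u^{\varepsilon}\|^2}D_2$, $C^{(5,6)}=\frac{1}{(1-\mathbf{i})^d}[\mathbf{i}^{-i-j}\Phi_{ij}]$. From $\mathcal{B}_6$: $C^{(6,1)}=\frac{(1-\mathbf{i})^d\langle u,u^{\varepsilon}\rangle}{\|u^{\varepsilon}\|^2}D_1$, $C^{(6,2)}=\frac{\langle u,u^{\varepsilon}\rangle}{\|u^{\varepsilon}\|^2}[\mathbf{i}^{-j}\Phi_{ij}]$, $C^{(6,3)}=\frac{\langle u^*,u^{\varepsilon}\rangle}{\|u^{\varepsilon}\|^2}[\Phi_{ij}]$,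 $C^{(6,4)}=\frac{\langle u^*,u^{\varepsilon}\rangle}{\|u^{\varepsilon}\|^2}[\mathbf{i}^{i}\Phi_{ij}]$, $C^{(6,5)}=\frac{1}{(1+\mathbf{i})^d}[\mathbf{i}^{i+j}\Phi_{ij}]$.
   Context: Let $D$ be a positive integer and let $Q_D$ be the $D$-cube: the graph with vertex set $X=\{0,1\}^D$, two vertices being adjacent iff they differ in exactly one coordinate; $\partial$ denotes path-length distance. $\mathrm{Mat}_X(\mathbb{C})$ is the algebra of complex matrices with rows and columns indexed by $X$, acting on $V=\mathbb{C}^X$ (column vectors) by left multiplication. $V$ carries the Hermitian inner product $\langle v,w\rangle=v^t\overline{w}$ (linear in the first argument), with $\|v\|^2=\langle v,v\rangle$. Write $\mathbf{i}^2=-1$ (the bold $\mathbf{i}$ is the imaginary unit; the plain $i$ is an index). Let $A$ be the adjacency matrix of $Q_D$. Fix $x=(0,0,\ldots,0)\in X$. Let $A^*$ be the diagonal matrix in $\mathrm{Mat}_X(\mathbb{C})$ with $(y,y)$-entry $D-2\partial(x,y)$ for $y\in X$, and let $A^{\varepsilon}=-\mathbf{i}(AA^*-A^*A)/2$. Let $T$ be the subalgebra of $\mathrm{Mat}_X(\mathbb{C})$ generated by $A$ and $A^*$. The eigenvalues of $A$ are $\theta_i=D-2i$ $(0\le i\le D)$. For $0\le i\le D$: $E_i=\prod_{0\le j\le D,\,j\ne i}\frac{A-\theta_jI}{\theta_i-\theta_j}$ is the primitive idempotent of $A$ for $\theta_i$ (the orthogonal projection onto the $\theta_i$-eigenspace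 of $A$); $E_i^*$ is the diagonal matrix with $(y,y)$-entry $1$ if $\partial(x,y)=i$ and $0$ otherwise; and $E_i^{\varepsilon}=P^{-1}E_iP$, where $P=P_1^{\otimes D}$ (Kronecker power, $P_{yz}=\prod_{k=1}^D(P_1)_{y_kz_k}$, invertible) with $P_1=\begin{pmatrix}1&1\\-\mathbf{i}&\mathbf{i}\end{pmatrix}$, rows and columns indexed by $0,1$ in that order. ($E_i^*$ and $E_i^{\varepsilon}$ are the primitive idempotents of $A^*$ and $A^{\varepsilon}$ for the eigenvalue $D-2i$.) A $T$-module is a subspace $W\subseteq V$ with $BW\subseteq W$ for all $B\in T$; it is irreducible if $W\ne0$ and it contains no $T$-modules other than $0$ and $W$. The endpoint of an irreducible $T$-module $W$ is $r=\min\{i\mid 0\le i\le D,\ E_i^*W\neq0\}$ (it is known that also $r=\min\{i\mid E_iW\ne0\}$), and its diameter is $d=|\{i\mid 0\le i\le D,\ E_i^*W\ne0\}|-1$; it is known that $d=D-2r$ and $0\le r\le D/2$. For nonzero $u\in E_rW$, $u^*\in E^*_rW$, $u^{\varepsilon}\in E^{\varepsilon}_rW$, each of the six sequences $\mathcal{B}_1,\ldots,\mathcal{B}_6$ in the claim is a basis of $W$. The transition matrix from a basis $u_0,\ldots,u_d$ of $W$ to a basis $v_0,\ldots,v_d$ of $W$ is the $(d+1)\times(d+1)$ complex matrix $C$ (rows and columns indexed $0,\ldots,d$) with $v_j=\sum_{i=0}^dC_{ij}u_i$ for $0\le j\le d$. For $a\in\mathbb{C}$ and an integer $n\ge0$,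 $(a)_n=a(a+1)\cdots(a+n-1)$ with $(a)_0=1$. For integers $0\le i,j\le d$, ${}_2F_1\big({-i,-j\atop -d};2\big)=\sum_{n=0}^d\frac{(-i)_n(-j)_n}{(-d)_n\,n!}2^n$ and $\Phi_{ij}=\binom{d}{j}\,{}_2F_1\big({-i,-j\atop -d};2\big)$. Further $D_1=\mathrm{diag}(\mathbf{i}^0,\mathbf{i}^1,\ldots,\mathbf{i}^d)$ and $D_2=\mathrm{diag}(\mathbf{i}^{-0},\mathbf{i}^{-1},\ldots,\mathbf{i}^{-d})$. *)

theory Defs
  imports "HOL-Analysis.Analysis"
begin

text \<open>
  The \<open>D\<close>-cube for \<open>D = CARD('n) \<ge> 1\<close>: the finite type \<open>'n\<close> indexes the
  coordinates, and a coordinate value \<open>0\<close> or \<open>1\<close> is \<^const>\<open>False\<close> or \<^const>\<open>True\<close>.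
\<close>

type_synonym 'n vertex = "'n \<Rightarrow> bool"
type_synonym 'n cvec = "complex ^ ('n vertex)"
type_synonym 'n cmat = "complex ^ ('n vertex) ^ ('n vertex)"


subsection \<open>The cube\<close>

definition cube_adj :: "'n::finite vertex \<Rightarrow> 'n vertex \<Rightarrow> bool" where
  "cube_adj y z \<longleftrightarrow> (\<exists>!k. y k \<noteq> z k)"

definition cube_dist :: "'n::finite vertex \<Rightarrow> 'n vertex \<Rightarrow> nat" where
  "cube_dist y z = (LEAST n. (cube_adj ^^ n) y z)"

definition origin :: "'n::finite vertex" where
  "origin = (\<lambda>_. False)"


subsection \<open>The matrices and the subconstituent algebra\<close>

definition adj_mat :: "'n::finite cmat" where
  "adj_mat = (\<chi> y z. if cube_adj y z then 1 else 0)"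

definition dual_adj_mat :: "'n::finite cmat" where
  "dual_adj_mat =
     (\<chi> y z. if y = z then of_nat CARD('n) - 2 * of_nat (cube_dist origin y) else 0)"

text \<open>
  On the type of matrices, \<open>*\<close> and \<open>1\<close> are componentwise, so subalgebras are stated with
  \<open>**\<close> and \<^term>\<open>mat 1\<close>; the scalar multiple of \<open>M\<close> by \<open>c\<close> is \<^term>\<open>mat c ** M\<close>.
\<close>

definition subalgebra :: "'n::finite cmat set \<Rightarrow> bool" where
  "subalgebra S \<longleftrightarrow> mat 1 \<in> S \<and>
     (\<forall>M\<in>S. \<forall>N\<in>S. M + N \<in> S) \<and>
     (\<forall>M\<in>S. \<forall>N\<in>S. M ** N \<in> S) \<and>
     (\<forall>c. \<forall>M\<in>S. mat c ** M \<in> S)"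

definition T_alg :: "'n::finite cmat set" where
  "T_alg = subalgebra hull {adj_mat, dual_adj_mat}"


subsection \<open>The three families of idempotents\<close>

definition theta :: "nat \<Rightarrow> nat \<Rightarrow> complex" where
  "theta D i = of_nat D - 2 * of_nat i"

text \<open>
  The factors of the product commute; they are multiplied in increasing order of \<open>j\<close>.
\<close>

definition E :: "nat \<Rightarrow> 'n::finite cmat" where
  "E i = (let D = CARD('n) in
     foldr (\<lambda>j M. (mat (1 / (theta D i - theta D j)) ** (adj_mat - mat (theta D j))) ** M)
       (filter (\<lambda>j. j \<noteq> i) [0..<Suc D]) (mat 1))"

definition E_star :: "nat \<Rightarrow> 'n::finite cmat" where
  "E_star i = (\<chi> y z. if y = z \<and> cube_dist origin y = i then 1 else 0)"

definition P1 :: "bool \<Rightarrow> bool \<Rightarrow> complex" where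
  "P1 a b = (if \<not> a then 1 else if \<not> b then - \<i> else \<i>)"

definition P :: "'n::finite cmat" where
  "P = (\<chi> y z. \<Prod>k\<in>UNIV. P1 (y k) (z k))"

definition E_eps :: "nat \<Rightarrow> 'n::finite cmat" where
  "E_eps i = matrix_inv P ** E i ** P"


subsection \<open>Modules\<close>

text \<open>
  \<^const>\<open>vec.subspace\<close>, \<^const>\<open>vec.span\<close> and \<^const>\<open>vec.independent\<close> refer to the
  complex vector space structure given by \<open>*s\<close>; the versions without the prefix are real.
\<close>

definition image_space :: "'n::finite cmat \<Rightarrow> 'n cvec set \<Rightarrow> 'n cvec set" where
  "image_space M W = (\<lambda>w. M *v w) ` W"

definition T_module :: "'n::finite cvec set \<Rightarrow> bool" where
  "T_module W \<longleftrightarrow> vec.subspace W \<and> (\<forall>B\<in>T_alg. image_space B W \<subseteq> W)"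

definition irreducible_T_module :: "'n::finite cvec set \<Rightarrow> bool" where
  "irreducible_T_module W \<longleftrightarrow> T_module W \<and> W \<noteq> {0} \<and>
     (\<forall>U. T_module U \<and> U \<subseteq> W \<longrightarrow> U = {0} \<or> U = W)"

definition endpoint :: "'n::finite cvec set \<Rightarrow> nat" where
  "endpoint W = Min {i. i \<le> CARD('n) \<and> image_space (E_star i) W \<noteq> {0}}"

definition module_diameter :: "'n::finite cvec set \<Rightarrow> nat" where
  "module_diameter W = card {i. i \<le> CARD('n) \<and> image_space (E_star i) W \<noteq> {0}} - 1"

definition cinner :: "'n::finite cvec \<Rightarrow> 'n cvec \<Rightarrow> complex" where
  "cinner v w = (\<Sum>y\<in>UNIV. v $ y * cnj (w $ y))"

definition cnorm_sq :: "'n::finite cvec \<Rightarrow> complex" where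
  "cnorm_sq v = cinner v v"


subsection \<open>Bases and transition matrices\<close>

text \<open>
  A basis \<open>b 0, \<dots>, b d\<close> is a function on \<^typ>\<open>nat\<close> of which only the values at
  \<open>0, \<dots>, d\<close> matter; likewise only the entries with \<open>i, j \<le> d\<close> of a
  \<open>(d + 1) \<times> (d + 1)\<close> matrix matter.
\<close>

definition is_basis :: "'n::finite cvec set \<Rightarrow> nat \<Rightarrow> (nat \<Rightarrow> 'n cvec) \<Rightarrow> bool" where
  "is_basis W d b \<longleftrightarrow>
     inj_on b {..d} \<and> vec.independent (b ` {..d}) \<and> vec.span (b ` {..d}) = W"

definition is_transition_matrix ::
  "'n::finite cvec set \<Rightarrow> nat \<Rightarrow> (nat \<Rightarrow> 'n cvec) \<Rightarrow> (nat \<Rightarrow> 'n cvec) \<Rightarrow>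
     (nat \<Rightarrow> nat \<Rightarrow> complex) \<Rightarrow> bool" where
  "is_transition_matrix W d u v C \<longleftrightarrow> is_basis W d u \<and> is_basis W d v \<and>
     (\<forall>j\<le>d. v j = (\<Sum>i\<le>d. C i j *s u i))"

definition hyp2F1 :: "nat \<Rightarrow> nat \<Rightarrow> nat \<Rightarrow> complex" where
  "hyp2F1 d i j = (\<Sum>n\<le>d. pochhammer (- of_nat i) n * pochhammer (- of_nat j) n
     / (pochhammer (- of_nat d) n * fact n) * 2 ^ n)"

definition Phi :: "nat \<Rightarrow> nat \<Rightarrow> nat \<Rightarrow> complex" where
  "Phi d i j = of_nat (d choose j) * hyp2F1 d i j"

definition diag :: "(nat \<Rightarrow> complex) \<Rightarrow> nat \<Rightarrow> nat \<Rightarrow> complex" where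
  "diag f i j = (if i = j then f i else 0)"

definition D1 :: "nat \<Rightarrow> nat \<Rightarrow> complex" where
  "D1 = diag (\<lambda>i. \<i> ^ i)"

definition D2 :: "nat \<Rightarrow> nat \<Rightarrow> complex" where
  "D2 = diag (\<lambda>i. \<i> powi (- int i))"

end

theory Submission
  imports Defs "HOL-Computational_Algebra.Polynomial"
begin

text \<open>
  A lowest-index vector \<open>u\<^sup>*\<close> of the module generates, under the lowering operator of \<open>sl2\<close>,
  a string of \<open>d + 1\<close> weight vectors; by irreducibility it spans \<open>W\<close>, and \<open>d = D - 2r\<close>.
  This identifies \<open>W\<close> with the polynomials of degree at most \<open>d\<close> in \<open>t\<close>, with
  \<open>u\<^sup>* = 1\<close>, \<open>u\<close> a multiple of \<open>(1 + t)\<^sup>d\<close> and \<open>u\<^sup>\<epsilon>\<close> a multiple of \<open>(1 - \<i>t)\<^sup>d\<close>.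
  By the binomial theorem each of the six bases consists, up to a common factor, of the
  polynomials \<open>binom d i X\<^sup>d\<^sup>-\<^sup>i Y\<^sup>i\<close> for a pair of linear forms \<open>X, Y\<close>. If
  \<open>X' = m (X + s Y)\<close> and \<open>Y' = m \<rho> (X - s Y)\<close>, the generating function of the Krawtchouk
  polynomials gives the transition matrix with entries \<open>m\<^sup>d s\<^sup>i \<rho>\<^sup>j \<Phi>\<^sub>i\<^sub>j\<close>. The common
  factors are expressed by inner products because eigenvectors of a Hermitian matrix for
  distinct eigenvalues are orthogonal.
\<close>

section \<open>The cube\<close>

definition flip :: "'n \<Rightarrow> 'n vertex \<Rightarrow> 'n vertex" where
  "flip k y = y(k := \<not> y k)"

text \<open>\<open>dual_adj_mat\<close> is diagonal and its entry is the sum of the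
  \<open>spin\<close>s of all coordinates (\<open>sum_spin\<close>), so its commutation relations
  reduce to the effect of a single flip.\<close>

definition spin :: "bool \<Rightarrow> complex" where
  "spin b = (if b then - 1 else 1)"

lemma flip_flip [simp]: "flip k (flip k y) = y"
  by (auto simp: flip_def)

lemma flip_commute: "flip k (flip l y) = flip l (flip k y)"
  by (auto simp: flip_def fun_eq_iff)

lemma flip_same [simp]: "flip k y k = (\<not> y k)"
  by (simp add: flip_def)

lemma flip_other [simp]: "l \<noteq> k \<Longrightarrow> flip k y l = y l"
  by (simp add: flip_def)

lemma bij_flip: "bij (flip k)"
  by (rule o_bij[where g = "flip k"]) (auto simp: fun_eq_iff)

lemma flip_eq_iff: "flip k y = flip l y \<longleftrightarrow> k = l"
  by (metis flip_other flip_same)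

lemma spin_Not [simp]: "spin (\<not> b) = - spin b"
  by (simp add: spin_def)

lemma cube_adj_iff: "cube_adj y z \<longleftrightarrow> (\<exists>k. z = flip k y)"
proof
  assume "cube_adj y z"
  then have "\<exists>k. y k \<noteq> z k \<and> (\<forall>l. y l \<noteq> z l \<longrightarrow> l = k)"
    unfolding cube_adj_def Ex1_def .
  then obtain k where k: "y k \<noteq> z k \<and> (\<forall>l. y l \<noteq> z l \<longrightarrow> l = k)" ..
  have "z = flip k y"
  proof
    fix l show "z l = flip k y l"
      using k by (cases "l = k") (simp, metis flip_other)
  qed
  then show "\<exists>k. z = flip k y" ..
next
  assume "\<exists>k. z = flip k y"
  then obtain k where "z = flip k y" ..
  then show "cube_adj y z" unfolding cube_adj_def
    by (intro ex1I[of _ k]) (auto simp: flip_def split: if_splits)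
qed

lemma sum_flip: "(\<Sum>y\<in>UNIV. g (flip k y)) = (\<Sum>y\<in>UNIV. g (y :: 'n::finite vertex))"
  using sum.reindex_bij_betw[OF bij_flip] .

lemma card_flip_le:
  fixes y :: "'n::finite vertex"
  shows "card {l. flip k y l} \<le> Suc (card {l. y l})"
proof -
  have "{l. flip k y l} \<subseteq> insert k {l. y l}" by (auto simp: flip_def split: if_splits)
  then have "card {l. flip k y l} \<le> card (insert k {l. y l})" by (intro card_mono) auto
  also have "\<dots> \<le> Suc (card {l. y l})" by (rule card_insert_le_m1) auto
  finally show ?thesis .
qed

text \<open>Switching on the coordinates of the support one by one gives a path of this length; no
  path is shorter, because a flip enlarges the support by at most one.\<close>

lemma cube_dist_origin: "cube_dist origin (y :: 'n::finite vertex) = card {k. y k}"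
  unfolding cube_dist_def
proof (rule Least_equality)
  have "(cube_adj ^^ card A) origin (\<lambda>k. k \<in> A)" if "finite A" for A :: "'n set"
    using that
  proof (induction A rule: finite_induct)
    case empty
    show ?case by (simp add: origin_def)
  next
    case (insert k A)
    have "(\<lambda>l. l \<in> insert k A) = flip k (\<lambda>l. l \<in> A)"
      using insert.hyps by (auto simp: flip_def fun_eq_iff)
    then have "cube_adj (\<lambda>l. l \<in> A) (\<lambda>l. l \<in> insert k A)" unfolding cube_adj_iff by blast
    with insert show ?case by (auto intro: relcomppI)
  qed
  from this[of "{k. y k}"] show "(cube_adj ^^ card {k. y k}) origin y" by simp
next
  fix n assume "(cube_adj ^^ n) origin y"
  then show "card {k. y k} \<le> n"
  proof (induction n arbitrary: y)
    case 0
    then show ?case by (auto simp: origin_def)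
  next
    case (Suc n)
    then obtain z where z: "(cube_adj ^^ n) origin z" "cube_adj z y" by auto
    then obtain k where "y = flip k z" by (auto simp: cube_adj_iff)
    with Suc.IH[OF z(1)] card_flip_le[of k z] show ?case by simp
  qed
qed

lemma cube_dist_origin_le: "cube_dist origin (y :: 'n::finite vertex) \<le> CARD('n)"
  unfolding cube_dist_origin by (intro card_mono) auto

lemma sum_spin:
  "(\<Sum>k\<in>UNIV. spin (y k)) = theta CARD('n) (cube_dist origin (y :: 'n::finite vertex))"
proof -
  have "(\<Sum>k\<in>UNIV. spin (y k)) = (\<Sum>k\<in>UNIV. 1 - 2 * (if y k then 1 else 0 :: complex))"
    by (intro sum.cong) (auto simp: spin_def)
  also have "\<dots> = of_nat CARD('n) - 2 * (\<Sum>k\<in>UNIV. if y k then 1 else 0)"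
    by (simp add: sum_subtractf sum_distrib_left)
  also have "(\<Sum>k\<in>UNIV. if y k then 1 else 0 :: complex) = of_nat (card {k. y k})"
    by (simp add: sum.If_cases)
  finally show ?thesis by (simp add: theta_def cube_dist_origin)
qed

lemma sum_spin_flip:
  "(\<Sum>l\<in>UNIV. spin (flip k y l)) = (\<Sum>l\<in>UNIV. spin ((y :: 'n::finite vertex) l)) - 2 * spin (y k)"
proof -
  have "(\<Sum>l\<in>UNIV. spin (flip k y l)) = - spin (y k) + (\<Sum>l\<in>UNIV-{k}. spin (flip k y l))"
    by (subst sum.remove[of _ k]) auto
  also have "(\<Sum>l\<in>UNIV-{k}. spin (flip k y l)) = (\<Sum>l\<in>UNIV-{k}. spin (y l))"
    by (intro sum.cong) auto
  also have "\<dots> = (\<Sum>l\<in>UNIV. spin (y l)) - spin (y k)"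
    by (subst sum.remove[of UNIV k]) auto
  finally show ?thesis by simp
qed

text \<open>Matrices supported on the edges are written as sums over the flipped coordinate; their
  action is then a sum over \<open>k\<close>, and operator identities can be checked term by
  term.\<close>

lemma sum_over_flips:
  fixes y :: "'n::finite vertex" and g :: "'n vertex \<Rightarrow> complex"
  shows "(\<Sum>z\<in>UNIV. (\<Sum>k\<in>UNIV. if z = flip k y then c k else 0) * g z)
    = (\<Sum>k\<in>UNIV. c k * g (flip k y))"
proof -
  have "(\<Sum>z\<in>UNIV. (\<Sum>k\<in>UNIV. if z = flip k y then c k else 0) * g z)
      = (\<Sum>k\<in>UNIV. \<Sum>z\<in>UNIV. if z = flip k y then c k * g z else 0)"
    unfolding sum_distrib_right by (subst sum.swap) (intro sum.cong, auto)
  then show ?thesis by simp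
qed

text \<open>
  The triple \<open>(up_mat, dual_adj_mat, down_mat)\<close> satisfies the relations of the standard
  basis of \<open>sl2\<close>, and \<open>eps_mat\<close> is the paper's \<open>A\<^sup>\<epsilon> = -\<i>(AA\<^sup>* - A\<^sup>*A)/2\<close>.
\<close>

definition up_mat :: "'n::finite cmat" where
  "up_mat = (\<chi> y z. \<Sum>k\<in>UNIV. if z = flip k y then of_bool (\<not> y k) else 0)"

definition down_mat :: "'n::finite cmat" where
  "down_mat = (\<chi> y z. \<Sum>k\<in>UNIV. if z = flip k y then of_bool (y k) else 0)"

definition eps_mat :: "'n::finite cmat" where
  "eps_mat = (\<chi> y z. \<Sum>k\<in>UNIV. if z = flip k y then \<i> * spin (y k) else 0)"

lemma up_mat_nth: "(up_mat *v g) $ y = (\<Sum>k\<in>UNIV. of_bool (\<not> y k) * g $ flip k y)"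
  by (simp add: up_mat_def matrix_vector_mult_def sum_over_flips)

lemma down_mat_nth: "(down_mat *v g) $ y = (\<Sum>k\<in>UNIV. of_bool (y k) * g $ flip k y)"
  by (simp add: down_mat_def matrix_vector_mult_def sum_over_flips)

lemma eps_mat_nth: "(eps_mat *v g) $ y = (\<Sum>k\<in>UNIV. \<i> * spin (y k) * g $ flip k y)"
  by (simp add: eps_mat_def matrix_vector_mult_def sum_over_flips)

lemma adj_mat_eq: "adj_mat $ y $ z = (\<Sum>k\<in>UNIV. if z = flip k y then 1 else 0)"
proof (cases "cube_adj y z")
  case True
  then obtain k where z: "z = flip k y" by (auto simp: cube_adj_iff)
  show ?thesis using True unfolding z by (simp add: adj_mat_def flip_eq_iff)
next
  case False
  then show ?thesis by (auto simp: adj_mat_def cube_adj_iff intro!: sum.neutral[symmetric])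
qed

lemma adj_mat_nth: "(adj_mat *v g) $ y = (\<Sum>k\<in>UNIV. g $ flip k y)"
  by (simp add: adj_mat_eq matrix_vector_mult_def sum_over_flips)

lemma dual_adj_mat_nth: "(dual_adj_mat *v g) $ y = (\<Sum>k\<in>UNIV. spin (y k)) * g $ y"
proof -
  have "(dual_adj_mat *v g) $ y
      = (\<Sum>z\<in>UNIV. if y = z then theta CARD('a) (cube_dist origin y) * g $ z else 0)"
    unfolding dual_adj_mat_def matrix_vector_mult_def theta_def
    by (simp add: if_distrib[of "\<lambda>x. x * _"] cong: if_cong)
  then show ?thesis by (simp add: sum_spin)
qed

lemma adj_mat_up_down: "adj_mat *v g = up_mat *v g + down_mat *v g"
  unfolding vec_eq_iff vector_add_component adj_mat_nth up_mat_nth down_mat_nth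
    sum.distrib[symmetric]
  by (intro allI sum.cong refl) simp

lemma eps_mat_up_down: "eps_mat *v g = \<i> *s (up_mat *v g - down_mat *v g)"
  unfolding vec_eq_iff vector_minus_component vector_smult_component eps_mat_nth up_mat_nth
    down_mat_nth sum_subtractf[symmetric] sum_distrib_left
  by (intro allI sum.cong refl) (simp add: spin_def)

text \<open>Only coordinates with \<open>y k\<close> false contribute, and flipping such a
  coordinate lowers the sum of spins by 2.\<close>

lemma dual_up: "dual_adj_mat *v (up_mat *v g) = up_mat *v (dual_adj_mat *v g) + 2 *s (up_mat *v g)"
  unfolding vec_eq_iff vector_add_component vector_smult_component dual_adj_mat_nth up_mat_nth
    sum_spin_flip sum_distrib_left[of _ _ UNIV] sum.distrib[symmetric]
  by (intro allI sum.cong refl) (simp add: spin_def algebra_simps)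

lemma dual_down:
  "dual_adj_mat *v (down_mat *v g) = down_mat *v (dual_adj_mat *v g) - 2 *s (down_mat *v g)"
  unfolding vec_eq_iff vector_minus_component vector_smult_component dual_adj_mat_nth down_mat_nth
    sum_spin_flip sum_distrib_left[of _ _ UNIV] sum_subtractf[symmetric]
  by (intro allI sum.cong refl) (simp add: spin_def algebra_simps)

text \<open>Both products are sums over ordered pairs of flips. For distinct coordinates the terms
  agree after the two coordinates exchange roles; for equal ones the flips undo each other and the
  difference is \<open>spin (y k) * g $ y\<close>.\<close>

lemma up_down: "up_mat *v (down_mat *v g) = down_mat *v (up_mat *v g) + dual_adj_mat *v g"
proof -
  have "(\<Sum>k\<in>UNIV. \<Sum>l\<in>UNIV. of_bool (\<not> y k) * (of_bool (flip k y l) * g $ flip l (flip k y)))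
      = (\<Sum>k\<in>UNIV. \<Sum>l\<in>UNIV. of_bool (y k) * (of_bool (\<not> flip k y l) * g $ flip l (flip k y)))
        + (\<Sum>k\<in>UNIV. spin (y k)) * g $ y" (is "?L = ?R + _") for y
  proof -
    have R: "?R = (\<Sum>k\<in>UNIV. \<Sum>l\<in>UNIV. of_bool (y l) * (of_bool (\<not> flip l y k) * g $ flip l (flip k y)))"
      by (subst sum.swap, subst flip_commute) (rule refl)
    have "?L = ?R + (\<Sum>k\<in>UNIV. \<Sum>l\<in>UNIV. if l = k then spin (y k) * g $ y else 0)"
      unfolding R sum.distrib[symmetric]
    proof (intro sum.cong refl)
      fix k l :: 'a
      show "of_bool (\<not> y k) * (of_bool (flip k y l) * g $ flip l (flip k y))
        = of_bool (y l) * (of_bool (\<not> flip l y k) * g $ flip l (flip k y))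
          + (if l = k then spin (y k) * g $ y else 0)"
        by (cases "l = k") (simp_all add: spin_def)
    qed
    also have "(\<Sum>k\<in>UNIV. \<Sum>l\<in>UNIV. if l = k then spin (y k) * g $ y else 0)
        = (\<Sum>k\<in>UNIV. spin (y k)) * g $ y"
      by (simp add: sum_distrib_right)
    finally show ?thesis .
  qed
  then show ?thesis
    unfolding vec_eq_iff vector_add_component up_mat_nth down_mat_nth dual_adj_mat_nth
      sum_distrib_left by (intro allI)
qed

section \<open>Eigenvectors and the idempotents\<close>

lemma theta_inj: "theta D i = theta D j \<longleftrightarrow> i = j"
  by (simp add: theta_def)

text \<open>The product defining \<open>E\<close> with a variable matrix in place of
  \<open>adj_mat\<close>, so that one computation serves both \<open>E\<close> and
  \<open>E_star\<close>.\<close>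

definition lagrange :: "'n::finite cmat \<Rightarrow> nat \<Rightarrow> 'n cmat" where
  "lagrange M i = (let D = CARD('n) in
     foldr (\<lambda>j N. (mat (1 / (theta D i - theta D j)) ** (M - mat (theta D j))) ** N)
       (filter (\<lambda>j. j \<noteq> i) [0..<Suc D]) (mat 1))"

lemma mat_mult_vec [simp]: "mat c *v v = c *s (v :: 'n::finite cvec)"
proof -
  have "(\<Sum>j\<in>UNIV. (if i = j then c else 0) * v $ j) = c * v $ i" for i
    by (simp add: if_distrib[of "\<lambda>x. x * _"] cong: if_cong)
  then show ?thesis by (simp add: vec_eq_iff mat_def matrix_vector_mult_def)
qed

lemma foldr_eigenvector:
  fixes v :: "'n::finite cvec"
  assumes "M *v v = c *s v"
  shows "foldr (\<lambda>j N. (mat (a j) ** (M - mat (b j))) ** N) js (mat 1) *v v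
    = (\<Prod>j\<leftarrow>js. a j * (c - b j)) *s v"
proof (induction js)
  case Nil
  show ?case by simp
next
  case (Cons j js)
  have "(M - mat (b j)) *v v = (c - b j) *s v"
    by (simp add: matrix_vector_mult_diff_rdistrib assms vector_sub_rdistrib)
  then have "(M - mat (b j)) *v (x *s v) = (x * (c - b j)) *s v" for x
    by (simp only: vector_scalar_commute vector_smult_assoc)
  with Cons show ?case
    by (simp flip: matrix_vector_mul_assoc add: vector_smult_assoc mult_ac del: vector_sub_rdistrib)
qed

text \<open>On an eigenvector every factor acts as a scalar, and the product of these scalars is the
  Lagrange basis polynomial of node \<open>i\<close> evaluated at node \<open>m\<close>.\<close>

lemma lagrange_eigenvector:
  fixes v :: "'n::finite cvec"
  assumes "M *v v = theta CARD('n) m *s v" "m \<le> CARD('n)" "i \<le> CARD('n)"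
  shows "lagrange M i *v v = (if i = m then v else 0)"
proof -
  let ?D = "CARD('n)"
  let ?p = "\<Prod>j\<leftarrow>filter (\<lambda>j. j \<noteq> i) [0..<Suc ?D].
    1 / (theta ?D i - theta ?D j) * (theta ?D m - theta ?D j)"
  have eq: "lagrange M i *v v = ?p *s v"
    unfolding lagrange_def Let_def by (rule foldr_eigenvector[OF assms(1)])
  have p: "?p = (\<Prod>j\<in>{..?D} - {i}. 1 / (theta ?D i - theta ?D j) * (theta ?D m - theta ?D j))"
    by (subst prod.distinct_set_conv_list[symmetric])
      (auto simp del: upt_Suc intro!: prod.cong)
  show ?thesis
  proof (cases "i = m")
    case True
    have "?p = 1" unfolding p using True by (intro prod.neutral) (auto simp: theta_inj)
    with eq True show ?thesis by simp
  next
    case False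
    \<comment> \<open>The factor with \<open>j = m\<close> is present, as
      \<open>m \<noteq> i\<close>, and it vanishes.\<close>
    then have "?p = 0" unfolding p using assms by (intro prod_zero) auto
    with eq False show ?thesis by simp
  qed
qed

lemma lagrange_closed:
  assumes "vec.subspace W" "\<And>g. g \<in> W \<Longrightarrow> M *v g \<in> W" "g \<in> W"
  shows "lagrange M i *v (g :: 'n::finite cvec) \<in> W"
proof -
  have "foldr (\<lambda>j N. (mat (a j) ** (M - mat (b j))) ** N) js (mat 1) *v g \<in> W" for a b js
    by (induction js) (auto simp flip: matrix_vector_mul_assoc
        simp: matrix_vector_mult_diff_rdistrib assms vec.subspace_scale vec.subspace_diff)
  then show ?thesis by (simp only: lagrange_def Let_def)
qed

lemma E_eq_lagrange: "E i = lagrange adj_mat i"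
  by (simp add: E_def lagrange_def)

lemma dual_axis:
  "dual_adj_mat *v axis y 1 = theta CARD('n) (cube_dist origin y) *s (axis y 1 :: 'n::finite cvec)"
  by (auto simp: vec_eq_iff dual_adj_mat_nth axis_def sum_spin)

lemma E_star_nth:
  "(E_star i *v g) $ y = (if cube_dist origin y = i then g $ y else 0)"
proof -
  have "(E_star i *v g) $ y
      = (\<Sum>z\<in>UNIV. if y = z then (if cube_dist origin y = i then g $ z else 0) else 0)"
    unfolding E_star_def matrix_vector_mult_def
    by (auto intro!: sum.cong simp: if_distrib[of "\<lambda>x. x * _"] cong: if_cong)
  then show ?thesis by simp
qed

lemma mult_axis_nth: "(M *v axis y 1) $ x = (M :: 'n::finite cmat) $ x $ y"
  by (simp add: matrix_vector_mult_def axis_def if_distrib[of "\<lambda>c. _ * c"] cong: if_cong)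

text \<open>The standard basis vectors are eigenvectors of \<open>dual_adj_mat\<close>, and both
  sides agree on them. So \<open>E_star i\<close> is a polynomial in \<open>dual_adj_mat\<close> and
  preserves every T-module.\<close>

lemma E_star_eq_lagrange:
  assumes "i \<le> CARD('n)"
  shows "(E_star i :: 'n::finite cmat) = lagrange dual_adj_mat i"
proof -
  have "E_star i *v axis y 1 = (lagrange dual_adj_mat i :: 'n cmat) *v axis y 1" for y
    unfolding lagrange_eigenvector[OF dual_axis cube_dist_origin_le assms]
    by (auto simp: vec_eq_iff E_star_nth axis_def)
  then have "E_star i $ x $ y = (lagrange dual_adj_mat i :: 'n cmat) $ x $ y" for x y
    by (metis mult_axis_nth)
  then show ?thesis by (simp add: vec_eq_iff)
qed

lemma dual_E_star: "dual_adj_mat *v (E_star i *v g) = theta CARD('n) i *s (E_star i *v (g :: 'n::finite cvec))"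
  by (auto simp: vec_eq_iff dual_adj_mat_nth E_star_nth sum_spin)

lemma E_star_sum: "(\<Sum>i\<le>CARD('n). E_star i *v g) = (g :: 'n::finite cvec)"
  by (simp add: vec_eq_iff sum_component E_star_nth cube_dist_origin_le)

text \<open>The eigenvalues of a diagonal matrix are its diagonal entries. This is what makes
  strings of weight vectors stop.\<close>

lemma dual_eigenvector_zero:
  fixes v :: "'n::finite cvec"
  assumes "dual_adj_mat *v v = c *s v" "\<And>i. i \<le> CARD('n) \<Longrightarrow> c \<noteq> theta CARD('n) i"
  shows "v = 0"
proof -
  have "v $ y = 0" for y
  proof -
    from assms(1) have "(dual_adj_mat *v v) $ y = (c *s v) $ y" by simp
    then have "(theta CARD('n) (cube_dist origin y) - c) * v $ y = 0"
      by (simp add: dual_adj_mat_nth sum_spin algebra_simps)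
    then show ?thesis using assms(2)[OF cube_dist_origin_le[of y]] by simp
  qed
  then show ?thesis by (simp add: vec_eq_iff)
qed

section \<open>The Kronecker power \<open>P\<close>, which conjugates \<open>eps_mat\<close> to
  \<open>adj_mat\<close>\<close>

lemma prod_P_split:
  "(P :: 'n::finite cmat) $ y $ z = P1 (y k) (z k) * (\<Prod>l\<in>UNIV - {k}. P1 (y l) (z l))"
  unfolding P_def by (simp add: prod.remove[of UNIV k])

text \<open>A flip moves from the column index to the row index by a 2 by 2 identity in coordinate
  \<open>k\<close>; the factors at the other coordinates are unaffected.\<close>

lemma P_flip_right: "P $ (y :: 'n::finite vertex) $ flip k z * (- \<i> * spin (z k)) = P $ flip k y $ z"
proof -
  have other: "(\<Prod>l\<in>UNIV - {k}. P1 (y l) (flip k z l)) = (\<Prod>l\<in>UNIV - {k}. P1 (flip k y l) (z l))"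
    by (intro prod.cong) auto
  have site: "P1 (y k) (flip k z k) * (- \<i> * spin (z k)) = P1 (flip k y k) (z k)"
    by (simp add: P1_def spin_def)
  show ?thesis
    unfolding prod_P_split[of y _ k] prod_P_split[of "flip k y" z k] other site[symmetric]
    by (simp only: mult_ac)
qed

lemma P_eps: "P *v (eps_mat *v g) = adj_mat *v (P *v (g :: 'n::finite cvec))"
proof -
  have "(\<Sum>z\<in>UNIV. P $ y $ z * (\<Sum>k\<in>UNIV. \<i> * spin (z k) * g $ flip k z))
      = (\<Sum>k\<in>UNIV. \<Sum>z\<in>UNIV. P $ flip k y $ z * g $ z)" for y
  proof -
    have "(\<Sum>z\<in>UNIV. P $ y $ z * (\<Sum>k\<in>UNIV. \<i> * spin (z k) * g $ flip k z))
      = (\<Sum>k\<in>UNIV. \<Sum>z\<in>UNIV. P $ y $ z * (\<i> * spin (z k) * g $ flip k z))"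
      unfolding sum_distrib_left by (rule sum.swap)
    also have "\<dots> = (\<Sum>k\<in>UNIV. \<Sum>z\<in>UNIV. P $ flip k y $ z * g $ z)"
    proof (rule sum.cong[OF refl])
      fix k
      show "(\<Sum>z\<in>UNIV. P $ y $ z * (\<i> * spin (z k) * g $ flip k z))
        = (\<Sum>z\<in>UNIV. P $ flip k y $ z * g $ z)"
        unfolding sum_flip[of "\<lambda>z. P $ y $ z * (\<i> * spin (z k) * g $ flip k z)" k, symmetric]
        by (simp add: mult_ac flip: P_flip_right[of y k])
    qed
    finally show ?thesis .
  qed
  then show ?thesis
    unfolding vec_eq_iff adj_mat_nth
    by (simp add: matrix_vector_mult_def[of P] eps_mat_nth)
qed

text \<open>\<open>P1\<close> times its conjugate transpose is twice the identity. Interchanging sum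
  and product reduces the claim to this, with the Kronecker power of half the conjugate transpose as
  inverse.\<close>

lemma matrix_inv_P: "matrix_inv P ** P = (mat 1 :: 'n::finite cmat)"
proof -
  let ?Q = "(\<chi> y z. \<Prod>k\<in>UNIV. cnj (P1 (z k) (y k)) / 2) :: 'n cmat"
  have "(\<Sum>z\<in>UNIV. (\<Prod>k\<in>UNIV. P1 (x k) (z k)) * (\<Prod>k\<in>UNIV. cnj (P1 (y k) (z k)) / 2))
      = (if x = y then 1 else 0)" for x y :: "'n vertex"
  proof -
    have "(\<Sum>z\<in>UNIV. (\<Prod>k\<in>UNIV. P1 (x k) (z k)) * (\<Prod>k\<in>UNIV. cnj (P1 (y k) (z k)) / 2))
        = (\<Sum>z\<in>PiE UNIV (\<lambda>_. UNIV). \<Prod>k\<in>UNIV. P1 (x k) (z k) * (cnj (P1 (y k) (z k)) / 2))"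
      unfolding prod.distrib by simp
    also have "\<dots> = (\<Prod>k\<in>UNIV. \<Sum>b\<in>UNIV. P1 (x k) b * (cnj (P1 (y k) b) / 2))"
      by (rule prod_sum_PiE[symmetric]) auto
    also have "\<dots> = (\<Prod>k\<in>UNIV. if x k = y k then 1 else 0)"
      by (intro prod.cong) (auto simp: UNIV_bool P1_def)
    also have "\<dots> = (if x = y then 1 else 0)" by (auto simp: fun_eq_iff)
    finally show ?thesis .
  qed
  then have PQ: "P ** ?Q = mat 1"
    by (simp add: P_def matrix_matrix_mult_def mat_def vec_eq_iff)
  then have "?Q ** P = mat 1" by (simp add: matrix_left_right_inverse)
  with PQ show ?thesis unfolding matrix_inv_def
    by (metis (mono_tags, lifting) someI_ex)
qed

lemma E_eigenvector:
  fixes v :: "'n::finite cvec"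
  assumes "adj_mat *v v = theta CARD('n) m *s v" "m \<le> CARD('n)" "i \<le> CARD('n)"
  shows "E i *v v = (if i = m then v else 0)"
  unfolding E_eq_lagrange using assms by (rule lagrange_eigenvector)

lemma E_star_eigenvector:
  fixes v :: "'n::finite cvec"
  assumes "dual_adj_mat *v v = theta CARD('n) m *s v" "m \<le> CARD('n)" "i \<le> CARD('n)"
  shows "E_star i *v v = (if i = m then v else 0)"
  unfolding E_star_eq_lagrange[OF assms(3)] using assms by (rule lagrange_eigenvector)

text \<open>\<open>P\<close> carries eigenvectors of \<open>eps_mat\<close> to eigenvectors of
  \<open>adj_mat\<close> for the same eigenvalue, which transfers the result for \<open>E\<close> to
  its conjugate.\<close>

lemma E_eps_eigenvector:
  fixes v :: "'n::finite cvec"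
  assumes "eps_mat *v v = theta CARD('n) m *s v" "m \<le> CARD('n)" "i \<le> CARD('n)"
  shows "E_eps i *v v = (if i = m then v else 0)"
proof -
  have "adj_mat *v (P *v v) = theta CARD('n) m *s (P *v v)"
    by (simp flip: P_eps add: assms vector_scalar_commute)
  from E_eigenvector[OF this assms(2,3)]
  have "E_eps i *v v = matrix_inv P *v (if i = m then P *v v else 0)"
    by (simp add: E_eps_def flip: matrix_vector_mul_assoc)
  moreover have "matrix_inv P *v (P *v v) = v"
    by (simp add: matrix_vector_mul_assoc matrix_inv_P)
  ultimately show ?thesis by simp
qed

section \<open>Orthogonality of eigenvectors\<close>

definition hermitian :: "'n::finite cmat \<Rightarrow> bool" where
  "hermitian M \<longleftrightarrow> (\<forall>y z. M $ y $ z = cnj (M $ z $ y))"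

lemma hermitian_cinner:
  assumes "hermitian M"
  shows "cinner (M *v v) w = cinner v (M *v w)"
proof -
  have "cinner (M *v v) w = (\<Sum>y\<in>UNIV. \<Sum>z\<in>UNIV. M $ y $ z * v $ z * cnj (w $ y))"
    by (simp add: cinner_def matrix_vector_mult_def sum_distrib_right)
  also have "\<dots> = (\<Sum>z\<in>UNIV. \<Sum>y\<in>UNIV. M $ y $ z * v $ z * cnj (w $ y))"
    by (rule sum.swap)
  also have "\<dots> = (\<Sum>z\<in>UNIV. v $ z * cnj (\<Sum>y\<in>UNIV. M $ z $ y * w $ y))"
    unfolding cnj_sum sum_distrib_left complex_cnj_mult
  proof (intro sum.cong refl)
    fix y z
    have "M $ y $ z = cnj (M $ z $ y)" by (rule assms[unfolded hermitian_def, rule_format])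
    then show "M $ y $ z * v $ z * cnj (w $ y) = v $ z * (cnj (M $ z $ y) * cnj (w $ y))"
      by (simp only: mult_ac)
  qed
  finally show ?thesis by (simp add: cinner_def matrix_vector_mult_def)
qed

lemma cinner_scale_left: "cinner (c *s v) w = c * cinner v w"
  by (simp add: cinner_def sum_distrib_left mult_ac)

lemma cinner_scale_right: "cinner v (c *s w) = cnj c * cinner v w"
  by (simp add: cinner_def sum_distrib_left mult_ac)

lemma cinner_sum_left: "cinner (\<Sum>i\<in>I. f i) w = (\<Sum>i\<in>I. cinner (f i) w)"
  unfolding cinner_def by (subst sum.swap) (simp add: sum_component sum_distrib_right)

lemma cnorm_sq_nonzero: "v \<noteq> 0 \<Longrightarrow> cnorm_sq v \<noteq> 0"
proof -
  assume "v \<noteq> 0"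
  then obtain y where y: "v $ y \<noteq> 0" by (auto simp: vec_eq_iff)
  have "cnorm_sq v = of_real (\<Sum>y\<in>UNIV. (cmod (v $ y))\<^sup>2)"
    unfolding cnorm_sq_def cinner_def complex_norm_square[symmetric] by simp
  moreover have "(\<Sum>y\<in>UNIV. (cmod (v $ y))\<^sup>2) > 0"
    using y by (intro sum_pos2[of _ y]) auto
  ultimately show ?thesis by (metis less_irrefl of_real_eq_0_iff)
qed

text \<open>The values \<open>theta D j\<close> are real, so the conjugation in the second argument
  of \<open>cinner\<close> leaves them unchanged.\<close>

lemma eigenvectors_orthogonal:
  assumes "hermitian M" "M *v v = theta D i *s v" "M *v w = theta D j *s w" "i \<noteq> j"
  shows "cinner v w = 0"
proof -
  have "theta D i * cinner v w = theta D j * cinner v w"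
    using hermitian_cinner[OF assms(1), of v w]
    by (simp add: assms(2,3) cinner_scale_left cinner_scale_right) (simp add: theta_def)
  with assms(4) show ?thesis by (simp add: theta_inj)
qed

lemma hermitian_adj: "hermitian adj_mat"
  unfolding hermitian_def adj_mat_eq cnj_sum
  by (intro allI sum.cong refl) (metis flip_flip complex_cnj_one complex_cnj_zero)

lemma hermitian_dual: "hermitian dual_adj_mat"
  by (simp add: hermitian_def dual_adj_mat_def)

lemma hermitian_eps: "hermitian eps_mat"
proof -
  have "(if z = flip k y then \<i> * spin (y k) else 0)
      = cnj (if y = flip k z then \<i> * spin (z k) else 0)" for y z :: "'a vertex" and k
  proof (cases "z = flip k y")
    case True
    then show ?thesis by (simp add: spin_def)
  next
    case False
    moreover from False have "y \<noteq> flip k z" by (metis flip_flip)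
    ultimately show ?thesis by simp
  qed
  then show ?thesis unfolding hermitian_def eps_mat_def vec_lambda_beta cnj_sum
    by (intro allI sum.cong refl)
qed

section \<open>The Krawtchouk generating function\<close>

lemma pochhammer_minus_of_nat:
  "pochhammer (- of_nat i :: complex) n = (- 1) ^ n * fact n * of_nat (i choose n)"
proof -
  have "(- 1) ^ n * fact n * (of_nat (i choose n) :: complex)
      = (- 1) ^ n * fact n * ((- 1) ^ n * pochhammer (- of_nat i) n / fact n)"
    unfolding binomial_gbinomial gbinomial_pochhammer ..
  also have "\<dots> = ((- 1) ^ n * (- 1) ^ n) * pochhammer (- of_nat i :: complex) n"
    by simp
  finally show ?thesis by (simp flip: power_mult_distrib)
qed

text \<open>The identity \<open>(d choose i) * (i choose n) = (d choose n) * ((d - n) choose (i -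
  n))\<close> cancels the denominator \<open>pochhammer (- of_nat d) n\<close>. The
  \<open>if\<close> discards \<open>n > i\<close>, where truncated subtraction would produce a
  spurious 1.\<close>

lemma choose_hyp2F1:
  assumes "i \<le> d"
  shows "of_nat (d choose i) * hyp2F1 d i j
    = (\<Sum>n\<le>d. of_nat (j choose n) * (- 2) ^ n * of_nat (if n \<le> i then (d - n) choose (i - n) else 0))"
  unfolding hyp2F1_def sum_distrib_left
proof (intro sum.cong refl)
  fix n assume "n \<in> {..d}"
  then have n: "n \<le> d" by simp
  have nz: "(of_nat (d choose n) :: complex) \<noteq> 0" using n by simp
  have two: "(- 2 :: complex) ^ n = (- 1) ^ n * 2 ^ n" by (simp flip: power_mult_distrib)
  have "(d choose i) * (i choose n) = (d choose n) * (if n \<le> i then (d - n) choose (i - n) else 0)"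
    using choose_mult[of n i d] assms by simp
  from arg_cong[where f = "of_nat :: nat \<Rightarrow> complex", OF this]
  have "of_nat (d choose i) * of_nat (i choose n)
    = (of_nat (d choose n) * of_nat (if n \<le> i then (d - n) choose (i - n) else 0) :: complex)"
    by (simp only: of_nat_mult)
  then show "of_nat (d choose i) * (pochhammer (- of_nat i) n * pochhammer (- of_nat j) n
        / (pochhammer (- of_nat d) n * fact n) * 2 ^ n)
      = (of_nat (j choose n) * (- 2) ^ n
          * of_nat (if n \<le> i then (d - n) choose (i - n) else 0) :: complex)"
    unfolding pochhammer_minus_of_nat two using nz by (simp add: divide_simps)
qed

text \<open>The binomial theorem for exponent \<open>d - n\<close>, reindexed by the total power
  \<open>i = n + k\<close> of \<open>T\<close>.\<close>

lemma binomial_shifted: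
  fixes X T :: "complex poly"
  assumes "n \<le> d"
  shows "T ^ n * (X + T) ^ (d - n)
    = (\<Sum>i\<le>d. of_nat (if n \<le> i then (d - n) choose (i - n) else 0) * (X ^ (d - i) * T ^ i))"
proof -
  have "T ^ n * (X + T) ^ (d - n)
      = (\<Sum>k\<le>d - n. of_nat ((d - n) choose k) * (X ^ (d - (n + k)) * T ^ (n + k)))"
    unfolding add.commute[of X] binomial_ring sum_distrib_left
    by (intro sum.cong) (auto simp: power_add algebra_simps)
  also have "\<dots> = (\<Sum>i\<in>{n..d}. of_nat ((d - n) choose (i - n)) * (X ^ (d - i) * T ^ i))"
    using assms by (intro sum.reindex_bij_witness[of _ "\<lambda>i. i - n" "\<lambda>k. n + k"]) auto
  also have "\<dots> = (\<Sum>i\<le>d. of_nat (if n \<le> i then (d - n) choose (i - n) else 0) * (X ^ (d - i) * T ^ i))"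
    by (intro sum.mono_neutral_cong_left) auto
  finally show ?thesis .
qed

lemma smult_sum_right: "smult c (\<Sum>i\<in>I. f i) = (\<Sum>i\<in>I. smult c (f i))"
  by (simp add: poly_eq_iff coeff_sum sum_distrib_left)

lemma of_nat_mult_poly: "of_nat n * p = smult (of_nat n) (p :: complex poly)"
  by (simp add: of_nat_poly)

text \<open>Expanding the \<open>j\<close>-th power of \<open>X - T = (X + T) - 2 T\<close> leaves
  multiples of \<open>T ^ n * (X + T) ^ (d - n)\<close>; \<open>binomial_shifted\<close> expands
  these and \<open>choose_hyp2F1\<close> sums the coefficients over \<open>n\<close>.\<close>

lemma krawtchouk_generating_function:
  fixes X T :: "complex poly"
  assumes "j \<le> d"
  shows "(X + T) ^ (d - j) * (X - T) ^ j
    = (\<Sum>i\<le>d. smult (of_nat (d choose i) * hyp2F1 d i j) (X ^ (d - i) * T ^ i))"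
proof -
  have "(X - T) ^ j = (smult (- 2) T + (X + T)) ^ j"
    by (rule arg_cong[where f = "\<lambda>p. p ^ j"]) (simp add: poly_eq_iff)
  also have "\<dots> = (\<Sum>n\<le>j. of_nat (j choose n) * smult (- 2) T ^ n * (X + T) ^ (j - n))"
    by (rule binomial_ring)
  finally have "(X + T) ^ (d - j) * (X - T) ^ j
      = (\<Sum>n\<le>j. smult (of_nat (j choose n) * (- 2) ^ n) (T ^ n * (X + T) ^ (d - n)))"
  proof -
    assume eq: "(X - T) ^ j = (\<Sum>n\<le>j. of_nat (j choose n) * smult (- 2) T ^ n * (X + T) ^ (j - n))"
    show ?thesis unfolding eq sum_distrib_left
    proof (intro sum.cong refl)
      fix n assume "n \<in> {..j}"
      then have "d - n = (d - j) + (j - n)" using assms by auto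
      then show "(X + T) ^ (d - j) * (of_nat (j choose n) * smult (- 2) T ^ n * (X + T) ^ (j - n))
        = smult (of_nat (j choose n) * (- 2) ^ n) (T ^ n * (X + T) ^ (d - n))"
        unfolding smult_power by (simp add: power_add of_nat_poly mult_ac)
    qed
  qed
  \<comment> \<open>The added terms vanish because \<open>j choose n = 0\<close> for
    \<open>n > j\<close>.\<close>
  also have "\<dots> = (\<Sum>n\<le>d. smult (of_nat (j choose n) * (- 2) ^ n) (T ^ n * (X + T) ^ (d - n)))"
    using assms by (intro sum.mono_neutral_left) auto
  also have "\<dots> = (\<Sum>n\<le>d. \<Sum>i\<le>d. smult (of_nat (j choose n) * (- 2) ^ n
      * of_nat (if n \<le> i then (d - n) choose (i - n) else 0)) (X ^ (d - i) * T ^ i))"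
  proof (intro sum.cong refl)
    fix n assume "n \<in> {..d}"
    then show "smult (of_nat (j choose n) * (- 2) ^ n) (T ^ n * (X + T) ^ (d - n))
      = (\<Sum>i\<le>d. smult (of_nat (j choose n) * (- 2) ^ n
      * of_nat (if n \<le> i then (d - n) choose (i - n) else 0)) (X ^ (d - i) * T ^ i))"
      by (simp only: binomial_shifted atMost_iff smult_sum_right of_nat_mult_poly smult_smult)
  qed
  also have "\<dots> = (\<Sum>i\<le>d. smult (of_nat (d choose i) * hyp2F1 d i j) (X ^ (d - i) * T ^ i))"
    by (subst sum.swap, intro sum.cong refl) (simp only: choose_hyp2F1 atMost_iff smult_sum)
  finally show ?thesis .
qed

section \<open>Binary forms\<close>

lemma matrix_vector_mult_sum: "M *v (\<Sum>i\<in>I. f i) = (\<Sum>i\<in>I. M *v (f i :: 'n::finite cvec))"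
  by (induction I rule: infinite_finite_induct) (auto simp: matrix_vector_right_distrib)

lemma vec_scale_sum: "c *s (\<Sum>i\<in>I. f i) = (\<Sum>i\<in>I. c *s (f i :: 'n::finite cvec))"
  by (rule vec.scale_sum_right)

text \<open>The scaling makes \<open>w k\<close> behave like the monomial \<open>t ^ k\<close>. The
  coefficients vanish at both ends: \<open>up_mat\<close> kills \<open>w 0\<close> although
  \<open>0 - 1 = 0\<close>, and \<open>down_mat\<close> kills \<open>w d\<close> whatever
  \<open>w (Suc d)\<close> is.\<close>

locale weight_string =
  fixes d r :: nat and w :: "nat \<Rightarrow> 'n::finite cvec"
  assumes card_eq: "d + 2 * r = CARD('n)"
    and up_w: "k \<le> d \<Longrightarrow> up_mat *v w k = of_nat k *s w (k - 1)"
    and down_w: "k \<le> d \<Longrightarrow> down_mat *v w k = (of_nat d - of_nat k) *s w (Suc k)"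
    and dual_w: "k \<le> d \<Longrightarrow> dual_adj_mat *v w k = theta CARD('n) (r + k) *s w k"
    and w_nonzero: "k \<le> d \<Longrightarrow> w k \<noteq> 0"
begin

lemma theta_eq: "theta CARD('n) (r + j) = of_nat d - 2 * of_nat j"
  unfolding theta_def card_eq[symmetric] by simp

text \<open>
  Under \<open>phi\<close>, which sends \<open>t\<^sup>k\<close> to \<open>w k\<close>, the raising operator becomes \<open>p \<mapsto> p'\<close>
  and the lowering operator \<open>p \<mapsto> d t p - t\<^sup>2 p'\<close>, the action of \<open>sl2\<close> on binary forms
  of degree \<open>d\<close>.
\<close>

definition phi :: "complex poly \<Rightarrow> 'n cvec" where
  "phi p = (\<Sum>k\<le>d. coeff p k *s w k)"

lemma phi_add: "phi (p + q) = phi p + phi q"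
  by (simp add: phi_def vec.scale_left_distrib sum.distrib)

lemma phi_diff: "phi (p - q) = phi p - phi q"
  by (simp add: phi_def vec.scale_left_diff_distrib sum_subtractf)

lemma phi_smult: "phi (smult c p) = c *s phi p"
  by (simp add: phi_def vec_scale_sum)

lemma phi_sum: "phi (\<Sum>i\<in>I. f i) = (\<Sum>i\<in>I. phi (f i))"
  by (induction I rule: infinite_finite_induct) (auto simp: phi_add, auto simp: phi_def)

lemma up_phi:
  assumes "degree p \<le> d"
  shows "up_mat *v phi p = phi (pderiv p)"
proof -
  have "up_mat *v phi p = (\<Sum>k\<le>d. (of_nat k * coeff p k) *s w (k - 1))"
    unfolding phi_def matrix_vector_mult_sum
    by (intro sum.cong refl) (simp add: vector_scalar_commute up_w mult.commute)
  also have "\<dots> = (\<Sum>k<d. (of_nat (Suc k) * coeff p (Suc k)) *s w k)"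
    by (subst sum.atMost_shift) simp
  also have "\<dots> = phi (pderiv p)"
  proof -
    \<comment> \<open>The coefficient of \<open>t ^ d\<close> in the derivative is thus zero, which
      matches the sum over \<open>k < d\<close>.\<close>
    have "coeff p (Suc d) = 0" using assms by (simp add: coeff_eq_0)
    then show ?thesis unfolding phi_def coeff_pderiv lessThan_Suc_atMost[symmetric] sum.lessThan_Suc
      by simp
  qed
  finally show ?thesis .
qed

lemma down_phi:
  assumes "degree p \<le> d"
  shows "down_mat *v phi p = phi (smult (of_nat d) ([:0, 1:] * p) - [:0, 0, 1:] * pderiv p)"
proof -
  have "down_mat *v phi p = (\<Sum>k\<le>d. ((of_nat d - of_nat k) * coeff p k) *s w (Suc k))"
    unfolding phi_def matrix_vector_mult_sum
    by (intro sum.cong refl)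
      (simp add: vector_scalar_commute down_w mult.commute del: vector_sub_rdistrib)
  \<comment> \<open>The term \<open>k = d\<close> drops out because its coefficient is
    \<open>d - d\<close>.\<close>
  also have "\<dots> = (\<Sum>k<d. ((of_nat d - of_nat k) * coeff p k) *s w (Suc k))"
    unfolding lessThan_Suc_atMost[symmetric] by simp
  also have "\<dots> = phi (smult (of_nat d) ([:0, 1:] * p) - [:0, 0, 1:] * pderiv p)"
  proof -
    let ?q = "smult (of_nat d) ([:0, 1:] * p) - [:0, 0, 1:] * pderiv p"
    have "coeff ?q 0 = 0" by simp
    moreover have "coeff ?q (Suc k) = (of_nat d - of_nat k) * coeff p k" for k
      by (cases k) (auto simp: coeff_pderiv algebra_simps)
    ultimately show ?thesis
      unfolding phi_def sum.atMost_shift by (simp del: mult_pCons_left vector_sub_rdistrib coeff_diff)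
  qed
  finally show ?thesis .
qed

text \<open>
  Eigenvectors of \<open>A\<close>, \<open>A\<^sup>*\<close> and \<open>A\<^sup>\<epsilon>\<close> correspond to products of powers of two linear
  forms; each of the six bases is a scalar multiple of some \<open>fam X Y\<close>.
\<close>

definition form :: "complex poly \<Rightarrow> complex poly \<Rightarrow> nat \<Rightarrow> 'n cvec" where
  "form X Y j = phi (X ^ (d - j) * Y ^ j)"

definition fam :: "complex poly \<Rightarrow> complex poly \<Rightarrow> nat \<Rightarrow> 'n cvec" where
  "fam X Y j = of_nat (d choose j) *s form X Y j"

lemma form_smult: "form X (smult c Y) j = c ^ j *s form X Y j"
  by (simp add: form_def smult_power phi_smult)

text \<open>The logarithmic derivative of \<open>X ^ a * Y ^ b\<close> with denominators cleared,
  which covers zero exponents as well.\<close>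

lemma pderiv_form:
  "X * Y * pderiv (X ^ a * Y ^ b)
    = (of_nat a * pderiv X * Y + of_nat b * X * pderiv Y) * (X ^ a * Y ^ b :: complex poly)"
proof -
  have power: "Z * pderiv (Z ^ n) = of_nat n * pderiv Z * Z ^ n" for Z :: "complex poly" and n
    by (cases n) (simp_all add: pderiv_power_Suc of_nat_poly mult_ac del: of_nat_Suc power_Suc,
        simp add: mult_ac)
  have "X * Y * pderiv (X ^ a * Y ^ b)
      = X * X ^ a * (Y * pderiv (Y ^ b)) + Y * Y ^ b * (X * pderiv (X ^ a))"
    by (simp add: pderiv_mult algebra_simps)
  then show ?thesis unfolding power by (simp only: algebra_simps)
qed

lemma degree_form:
  assumes "degree X \<le> 1" "degree Y \<le> 1" "j \<le> d"
  shows "degree (X ^ (d - j) * Y ^ j :: complex poly) \<le> d"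
proof -
  have "degree (X ^ (d - j) * Y ^ j) \<le> degree X * (d - j) + degree Y * j"
    by (intro order.trans[OF degree_mult_le] add_mono degree_power_le)
  also have "\<dots> \<le> 1 * (d - j) + 1 * j" using assms by (intro add_mono mult_right_mono) auto
  finally show ?thesis using assms by simp
qed

lemma form_std:
  assumes j: "j \<le> d"
  shows "form 1 [:0, 1:] j = w j"
proof -
  have x_pow: "[:0, 1:] ^ j = monom (1 :: complex) j" by (simp add: monom_altdef)
  have "form 1 [:0, 1:] j = (\<Sum>k\<le>d. if k = j then w k else 0)"
    unfolding form_def phi_def by (intro sum.cong) (auto simp: x_pow)
  then show ?thesis using j by simp
qed

lemma dual_form:
  "j \<le> d \<Longrightarrow>
    dual_adj_mat *v form 1 [:0, 1:] j = theta CARD('n) (r + j) *s form 1 [:0, 1:] j"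
  by (simp add: form_std dual_w)

text \<open>On polynomials \<open>adj_mat\<close> acts as
  \<open>p \<mapsto> d t p + (1 - t^2) p'\<close>. Since \<open>1 - t^2\<close> is the product of
  the two linear forms, \<open>pderiv_form\<close> turns the action into multiplication by a
  polynomial in which \<open>t\<close> cancels.\<close>

lemma adj_form:
  assumes j: "j \<le> d"
  shows "adj_mat *v form [:1, 1:] [:1, -1:] j = theta CARD('n) (r + j) *s form [:1, 1:] [:1, -1:] j"
proof -
  let ?p = "[:1, 1:] ^ (d - j) * [:1, -1:] ^ j :: complex poly"
  have "degree ?p \<le> d" by (intro degree_form j) auto
  then have "adj_mat *v phi ?p
      = phi (smult (of_nat d) ([:0, 1:] * ?p) + [:1, 1:] * [:1, -1:] * pderiv ?p)"
  proof -
    assume deg: "degree ?p \<le> d"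
    have split: "[:1, 1:] * [:1, -1:] = 1 - [:0, 0, 1 :: complex:]" by (simp add: one_pCons)
    show ?thesis
      unfolding adj_mat_up_down up_phi[OF deg] down_phi[OF deg] phi_add[symmetric] split
      by (rule arg_cong[where f = phi]) (simp only: left_diff_distrib, simp)
  qed
  also have "smult (of_nat d) ([:0, 1:] * ?p) + [:1, 1:] * [:1, -1:] * pderiv ?p
      = smult (of_nat d - 2 * of_nat j) ?p"
  proof -
    have "smult (of_nat d) ([:0, 1:] * ?p) + [:1, 1:] * [:1, -1:] * pderiv ?p
      = ([:0, of_nat d:] + (of_nat (d - j) * pderiv [:1, 1:] * [:1, -1:]
          + of_nat j * [:1, 1:] * pderiv [:1, -1:])) * ?p"
      unfolding pderiv_form distrib_right by simp
    also have "[:0, of_nat d:] + (of_nat (d - j) * pderiv [:1, 1:] * [:1, -1:]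
          + of_nat j * [:1, 1:] * pderiv [:1, -1:]) = [:of_nat d - 2 * of_nat j :: complex:]"
      using j by (simp add: pderiv_pCons of_nat_poly of_nat_diff algebra_simps)
    finally show ?thesis by simp
  qed
  finally show ?thesis unfolding form_def phi_smult theta_eq .
qed

text \<open>Here the operator is \<open>p \<mapsto> \<i> ((1 + t^2) p' - d t p)\<close> and
  \<open>1 + t^2 = (1 - \<i> t) (1 + \<i> t)\<close>, so the same cancellation occurs.\<close>

lemma eps_form:
  assumes j: "j \<le> d"
  shows "eps_mat *v form [:1, - \<i>:] [:1, \<i>:] j = theta CARD('n) (r + j) *s form [:1, - \<i>:] [:1, \<i>:] j"
proof -
  let ?p = "[:1, - \<i>:] ^ (d - j) * [:1, \<i>:] ^ j :: complex poly"
  have "degree ?p \<le> d" by (intro degree_form j) auto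
  then have "eps_mat *v phi ?p
      = phi (smult \<i> ([:1, - \<i>:] * [:1, \<i>:] * pderiv ?p - smult (of_nat d) ([:0, 1:] * ?p)))"
  proof -
    assume deg: "degree ?p \<le> d"
    have split: "[:1, - \<i>:] * [:1, \<i>:] = 1 + [:0, 0, 1:]" by (simp add: one_pCons)
    show ?thesis
      unfolding eps_mat_up_down up_phi[OF deg] down_phi[OF deg] phi_diff[symmetric] split phi_smult
      by (rule arg_cong[where f = "\<lambda>p. \<i> *s phi p"]) (simp only: distrib_right, simp)
  qed
  also have "smult \<i> ([:1, - \<i>:] * [:1, \<i>:] * pderiv ?p - smult (of_nat d) ([:0, 1:] * ?p))
      = smult (of_nat d - 2 * of_nat j) ?p"
  proof -
    have "smult \<i> ([:1, - \<i>:] * [:1, \<i>:] * pderiv ?p - smult (of_nat d) ([:0, 1:] * ?p))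
      = [:\<i>:] * ((of_nat (d - j) * pderiv [:1, - \<i>:] * [:1, \<i>:]
          + of_nat j * [:1, - \<i>:] * pderiv [:1, \<i>:]) - [:0, of_nat d:]) * ?p"
    proof -
      have "smult \<i> (A * p - smult c ([:0, 1:] * p)) = [:\<i>:] * (A - [:0, c:]) * p"
        for A p :: "complex poly" and c
        by (simp add: left_diff_distrib smult_diff_right)
      then show ?thesis unfolding pderiv_form by this
    qed
    also have "[:\<i>:] * ((of_nat (d - j) * pderiv [:1, - \<i>:] * [:1, \<i>:]
          + of_nat j * [:1, - \<i>:] * pderiv [:1, \<i>:]) - [:0, of_nat d:])
        = [:of_nat d - 2 * of_nat j :: complex:]"
      using j by (simp add: pderiv_pCons of_nat_poly of_nat_diff algebra_simps)
    finally show ?thesis by simp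
  qed
  finally show ?thesis unfolding form_def phi_smult theta_eq .
qed

end

lemma span_mult_closed:
  assumes "g \<in> vec.span S" "\<And>x. x \<in> S \<Longrightarrow> M *v x \<in> vec.span T"
  shows "M *v g \<in> vec.span (T :: 'n::finite cvec set)"
proof -
  have "vec.subspace {x. M *v x \<in> vec.span T}"
    by (auto simp: vec.subspace_def matrix_vector_right_distrib vector_scalar_commute
        intro: vec.span_add vec.span_scale vec.span_zero)
  then have "vec.span S \<subseteq> {x. M *v x \<in> vec.span T}"
    using assms(2) by (intro vec.span_minimal) auto
  with assms(1) show ?thesis by auto
qed

section \<open>Families of forms, idempotents and changes of linear forms\<close>

context weight_string
begin

definition eigenforms :: "'n cmat \<Rightarrow> complex poly \<Rightarrow> complex poly \<Rightarrow> bool" where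
  "eigenforms M X Y \<longleftrightarrow> (\<forall>j\<le>d. M *v form X Y j = theta CARD('n) (r + j) *s form X Y j)"

definition projects :: "(nat \<Rightarrow> 'n cmat) \<Rightarrow> complex poly \<Rightarrow> complex poly \<Rightarrow> bool" where
  "projects Q X Y \<longleftrightarrow> (\<forall>i\<le>d. \<forall>j\<le>d. Q (r + i) *v form X Y j = (if i = j then form X Y j else 0))"

text \<open>Rescaling \<open>Y\<close> multiplies the \<open>j\<close>-th form by
  \<open>c ^ j\<close>. This freedom is used to make \<open>X + Y\<close> proportional to the linear
  form of the vector that generates a basis.\<close>

lemma eigenforms_smult: "eigenforms M X Y \<Longrightarrow> eigenforms M X (smult c Y)"
  by (simp add: eigenforms_def form_smult vector_scalar_commute vector_smult_assoc mult_ac)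

lemma projects_smult: "projects Q X Y \<Longrightarrow> projects Q X (smult c Y)"
  by (auto simp: projects_def form_smult vector_scalar_commute)

lemma eigenforms_star: "eigenforms dual_adj_mat 1 [:0, 1:]"
  by (simp add: eigenforms_def dual_form)

lemma eigenforms_adj: "eigenforms adj_mat [:1, 1:] [:1, -1:]"
  unfolding eigenforms_def using adj_form by blast

lemma eigenforms_eps: "eigenforms eps_mat [:1, - \<i>:] [:1, \<i>:]"
  unfolding eigenforms_def using eps_form by blast

lemma projects_star: "projects E_star 1 [:0, 1:]"
  unfolding projects_def
proof (intro allI impI)
  fix i j assume "i \<le> d" "j \<le> d"
  then show "E_star (r + i) *v form 1 [:0, 1:] j = (if i = j then form 1 [:0, 1:] j else 0)"
    using E_star_eigenvector[of "form 1 [:0, 1:] j" "r + j" "r + i"] eigenforms_star card_eq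
    by (auto simp: eigenforms_def)
qed

lemma projects_E: "projects E [:1, 1:] [:1, -1:]"
  unfolding projects_def
proof (intro allI impI)
  fix i j assume "i \<le> d" "j \<le> d"
  then show "E (r + i) *v form [:1, 1:] [:1, -1:] j = (if i = j then form [:1, 1:] [:1, -1:] j else 0)"
    using E_eigenvector[of "form [:1, 1:] [:1, -1:] j" "r + j" "r + i"] eigenforms_adj card_eq
    by (auto simp: eigenforms_def)
qed

lemma projects_eps: "projects E_eps [:1, - \<i>:] [:1, \<i>:]"
  unfolding projects_def
proof (intro allI impI)
  fix i j assume "i \<le> d" "j \<le> d"
  then show "E_eps (r + i) *v form [:1, - \<i>:] [:1, \<i>:] j = (if i = j then form [:1, - \<i>:] [:1, \<i>:] j else 0)"
    using E_eps_eigenvector[of "form [:1, - \<i>:] [:1, \<i>:] j" "r + j" "r + i"] eigenforms_eps card_eq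
    by (auto simp: eigenforms_def)
qed

lemma phi_power:
  assumes "Z = smult a (X + Y)"
  shows "phi (Z ^ d) = a ^ d *s (\<Sum>i\<le>d. fam X Y i)"
proof -
  have "phi ((X + Y) ^ d) = (\<Sum>i\<le>d. fam X Y i)"
    unfolding add.commute[of X] binomial_ring phi_sum fam_def form_def
    by (intro sum.cong refl) (simp add: of_nat_mult_poly phi_smult mult_ac)
  then show ?thesis by (simp add: assms smult_power phi_smult)
qed

text \<open>The binomial theorem splits \<open>Z ^ d\<close> into the \<open>fam X Y j\<close>, of
  which \<open>Q (r + i)\<close> keeps one. Hence each of the six bases is a scalar multiple of a
  family.\<close>

lemma projects_phi_power:
  assumes "projects Q X Y" "Z = smult a (X + Y)" "i \<le> d"
  shows "Q (r + i) *v phi (Z ^ d) = a ^ d *s fam X Y i"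
proof -
  have "Q (r + i) *v fam X Y j = (if j = i then fam X Y i else 0)" if "j \<le> d" for j
    using assms(1,3) that by (auto simp: projects_def fam_def vector_scalar_commute)
  then show ?thesis
    unfolding phi_power[OF assms(2)] vector_scalar_commute matrix_vector_mult_sum
    using assms(3) by simp
qed

lemma fam_0: "fam X Y 0 = phi (X ^ d)"
  by (simp add: fam_def form_def)

text \<open>In the binomial expansion of \<open>Z ^ d\<close> all terms except \<open>X ^ d\<close>
  are orthogonal to \<open>u\<close>. The factor \<open>cnj b\<close> is common to both sides, so
  only \<open>b\<close> remains in the denominator.\<close>

lemma cinner_phi_power:
  assumes "eigenforms M X Y" "hermitian M" "Z = smult a (X + Y)" "b \<noteq> 0"
    "v = c *s phi (Z ^ d)" "u = b *s phi (X ^ d)"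
  shows "cinner v u = c * a ^ d / b * cnorm_sq u"
proof -
  have orth: "cinner (fam X Y i) (phi (X ^ d)) = (if i = 0 then cinner (phi (X ^ d)) (phi (X ^ d)) else 0)"
    if "i \<le> d" for i
  proof (cases "i = 0")
    case True
    then show ?thesis by (simp add: fam_0)
  next
    case False
    have "cinner (form X Y i) (form X Y 0) = 0"
      using assms(1) that False unfolding eigenforms_def
      by (intro eigenvectors_orthogonal[OF assms(2), of _ "CARD('n)" "r + i" _ "r + 0"]) auto
    with False show ?thesis by (simp add: fam_def cinner_scale_left form_def)
  qed
  have "cinner (phi (Z ^ d)) (phi (X ^ d)) = a ^ d * cinner (phi (X ^ d)) (phi (X ^ d))"
    unfolding phi_power[OF assms(3)] cinner_scale_left cinner_sum_left
    by (simp add: orth)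
  with assms(4) show ?thesis
    unfolding assms(5,6) cnorm_sq_def cinner_scale_left cinner_scale_right by simp
qed

text \<open>The generating function with \<open>T = smult s Y\<close>. The binomial coefficients
  inside \<open>fam\<close> turn \<open>hyp2F1\<close> into \<open>Phi\<close>: that of
  \<open>j\<close> enters \<open>Phi d i j\<close>, that of \<open>i\<close> enters
  \<open>fam X Y i\<close>.\<close>

lemma fam_transition:
  assumes "j \<le> d" "X' = smult m (X + smult s Y)" "Y' = smult (m * t) (X - smult s Y)"
  shows "fam X' Y' j = (\<Sum>i\<le>d. (m ^ d * (s ^ i * t ^ j * Phi d i j)) *s fam X Y i)"
proof -
  have m: "m ^ (d - j) * (m * t) ^ j = m ^ d * t ^ j"
    using assms(1) by (simp add: power_mult_distrib flip: power_add mult.assoc)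
  have "form X' Y' j
      = (m ^ d * t ^ j) *s phi ((X + smult s Y) ^ (d - j) * (X - smult s Y) ^ j)"
    unfolding m[symmetric] by (simp add: form_def assms(2,3) smult_power phi_smult mult_ac)
  also have "\<dots> = (\<Sum>i\<le>d. (m ^ d * t ^ j * (of_nat (d choose i) * hyp2F1 d i j)) *s form X (smult s Y) i)"
    unfolding krawtchouk_generating_function[OF assms(1)] phi_sum vec_scale_sum phi_smult form_def
      vector_smult_assoc by (rule refl)
  finally show ?thesis
    unfolding fam_def form_smult Phi_def
    by (simp add: vec_scale_sum vector_smult_assoc mult_ac)
qed

text \<open>The factors \<open>p\<close> and \<open>q\<close> of the two bases and the power
  \<open>m ^ d\<close> are absorbed into one constant \<open>\<kappa>\<close>, the prefactor of the
  transition matrix.\<close>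

lemma transition:
  assumes b: "\<And>i. i \<le> d \<Longrightarrow> b i = p *s fam X Y i"
    and b': "\<And>i. i \<le> d \<Longrightarrow> b' i = q *s fam X' Y' i"
    and "X' = smult m (X + smult s Y)" "Y' = smult (m * t) (X - smult s Y)"
    and pq: "q * m ^ d = \<kappa> * p"
    and C: "\<And>i j. C i j = \<kappa> * (s ^ i * t ^ j * Phi d i j)"
  shows "\<forall>j\<le>d. b' j = (\<Sum>i\<le>d. C i j *s b i)"
proof (intro allI impI)
  fix j assume j: "j \<le> d"
  have "b' j = (\<Sum>i\<le>d. (q * m ^ d * (s ^ i * t ^ j * Phi d i j)) *s fam X Y i)"
    unfolding b'[OF j] fam_transition[OF j assms(3,4)] vec_scale_sum vector_smult_assoc
    by (simp add: mult_ac)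
  also have "\<dots> = (\<Sum>i\<le>d. C i j *s b i)"
    unfolding pq by (intro sum.cong refl) (simp add: C b vector_smult_assoc mult_ac)
  finally show "b' j = (\<Sum>i\<le>d. C i j *s b i)" .
qed

text \<open>The case of two bases cut out by the same idempotents: the linear forms agree up to
  scalars and nothing mixes.\<close>

lemma transition_diag:
  assumes b: "\<And>i. i \<le> d \<Longrightarrow> b i = p *s fam X Y i"
    and b': "\<And>i. i \<le> d \<Longrightarrow> b' i = q *s fam X' Y' i"
    and "X' = smult m X" "Y' = smult (m * s) Y"
    and pq: "q * m ^ d = \<kappa> * p"
    and C: "\<And>i j. C i j = \<kappa> * diag (\<lambda>i. s ^ i) i j"
  shows "\<forall>j\<le>d. b' j = (\<Sum>i\<le>d. C i j *s b i)"
proof (intro allI impI)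
  fix j assume j: "j \<le> d"
  have "m ^ (d - j) * (m * s) ^ j = m ^ d * s ^ j"
    using j by (simp add: power_mult_distrib flip: power_add mult.assoc)
  then have "fam X' Y' j = (m ^ d * s ^ j) *s fam X Y j"
    by (simp add: fam_def form_def assms(3,4) smult_power phi_smult vector_smult_assoc mult_ac)
  then have "b' j = (q * m ^ d * s ^ j) *s fam X Y j"
    using b'[OF j] by (simp add: vector_smult_assoc mult_ac)
  also have "\<dots> = (\<kappa> * s ^ j) *s b j"
    unfolding pq by (simp add: b[OF j] vector_smult_assoc mult_ac)
  also have "\<dots> = (\<Sum>i\<le>d. if i = j then (\<kappa> * s ^ j) *s b j else 0)"
    using j by simp
  also have "\<dots> = (\<Sum>i\<le>d. C i j *s b i)"
    by (intro sum.cong refl) (auto simp: C diag_def)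
  finally show "b' j = (\<Sum>i\<le>d. C i j *s b i)" .
qed

section \<open>The span of a weight string: dimension, bases and projections\<close>

definition string_span :: "'n cvec set" where
  "string_span = vec.span (w ` {..d})"

lemma phi_in_span: "phi p \<in> string_span"
  unfolding phi_def string_span_def
  by (intro vec.span_sum vec.span_scale vec.span_base) auto

lemma fam_in_span: "fam X Y i \<in> string_span"
  using phi_in_span unfolding fam_def form_def string_span_def by (intro vec.span_scale)

lemma fam_std: "j \<le> d \<Longrightarrow> fam 1 [:0, 1:] j = of_nat (d choose j) *s w j"
  by (simp add: fam_def form_std)

lemma E_star_w: "i \<le> d \<Longrightarrow> j \<le> d \<Longrightarrow> E_star (r + i) *v w j = (if i = j then w j else 0)"
  using projects_star by (simp add: projects_def form_std)

lemma inj_w: "inj_on w {..d}"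
  by (intro inj_onI) (metis E_star_w atMost_iff w_nonzero)

lemma independent_w: "vec.independent (w ` {..d})"
proof (rule vec.independent_if_scalars_zero)
  fix f x
  assume "(\<Sum>x\<in>w ` {..d}. f x *s x) = 0" and "x \<in> w ` {..d}"
  then obtain k where k: "k \<le> d" "x = w k" and sum: "(\<Sum>j\<le>d. f (w j) *s w j) = 0"
    by (auto simp: sum.reindex[OF inj_w])
  have "0 = E_star (r + k) *v (\<Sum>j\<le>d. f (w j) *s w j)" unfolding sum by simp
  also have "\<dots> = (\<Sum>j\<le>d. if j = k then f (w k) *s w k else 0)"
    unfolding matrix_vector_mult_sum
    by (intro sum.cong refl) (use k in \<open>auto simp: vector_scalar_commute E_star_w\<close>)
  also have "\<dots> = f x *s x" using k by simp
  finally show "f x = 0" using w_nonzero[OF k(1)] k(2) by simp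
qed simp

lemma dim_string_span: "vec.dim string_span = Suc d"
  unfolding string_span_def vec.dim_span
  by (simp add: vec.dim_eq_card_independent[OF independent_w] card_image[OF inj_w])

text \<open>Vectors that combine to nonzero multiples of all \<open>w j\<close> span; as there are
  \<open>d + 1\<close> of them and the dimension is \<open>d + 1\<close>, distinctness and
  independence follow by counting.\<close>

lemma is_basisI:
  assumes b: "\<And>i. i \<le> d \<Longrightarrow> b i \<in> string_span"
    and std: "\<forall>j\<le>d. p *s fam 1 [:0, 1:] j = (\<Sum>i\<le>d. C i j *s b i)" and p: "p \<noteq> 0"
  shows "is_basis string_span d b"
proof -
  have "w j \<in> vec.span (b ` {..d})" if "j \<le> d" for j
  proof -
    have "(\<Sum>i\<le>d. C i j *s b i) \<in> vec.span (b ` {..d})"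
      by (intro vec.span_sum vec.span_scale vec.span_base) auto
    then have "(p * of_nat (d choose j)) *s w j \<in> vec.span (b ` {..d})"
      using std that by (simp add: fam_std vector_smult_assoc flip: std)
    then have "inverse (p * of_nat (d choose j)) *s ((p * of_nat (d choose j)) *s w j)
        \<in> vec.span (b ` {..d})" by (rule vec.span_scale)
    moreover have "p * of_nat (d choose j) \<noteq> 0" using p that by simp
    ultimately show ?thesis by (metis vector_smult_assoc left_inverse vector_smult_lid)
  qed
  then have sub: "string_span \<subseteq> vec.span (b ` {..d})"
    unfolding string_span_def by (intro vec.span_minimal vec.subspace_span) auto
  have sub': "b ` {..d} \<subseteq> string_span" using b by auto
  have span: "vec.span (b ` {..d}) = string_span"
    using sub sub' by (intro antisym vec.span_minimal) (auto simp: string_span_def)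
  have le: "card (b ` {..d}) \<le> Suc d" using card_image_le[of "{..d}" b] by simp
  have ge: "Suc d \<le> card (b ` {..d})"
    using vec.dim_le_card[OF sub] by (simp add: dim_string_span)
  have "inj_on b {..d}" using le ge by (intro eq_card_imp_inj_on) auto
  moreover have "vec.independent (b ` {..d})"
    using le by (intro vec.card_le_dim_spanning[OF sub' sub]) (auto simp: dim_string_span)
  ultimately show ?thesis unfolding is_basis_def using span by blast
qed

text \<open>The forms \<open>1\<close> and \<open>t\<close> are expressed through \<open>X\<close>
  and \<open>Y\<close>, so every \<open>w j\<close> is a combination of the
  \<open>fam X Y i\<close>, and \<open>Q r\<close> kills all of these but the one of index 0. This
  identifies \<open>u\<close> and \<open>ue\<close> up to scalars.\<close>

lemma projects_span:
  assumes "projects Q X Y" "1 = smult m (X + smult s Y)" "[:0, 1:] = smult (m * t) (X - smult s Y)"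
    and "g \<in> string_span"
  shows "\<exists>c. Q r *v g = c *s phi (X ^ d)"
proof -
  have "Q r *v w j \<in> vec.span {phi (X ^ d)}" if j: "j \<le> d" for j
  proof -
    have "w j = (1 / of_nat (d choose j)) *s fam 1 [:0, 1:] j"
      using j by (simp add: fam_std vector_smult_assoc)
    moreover have "Q r *v fam X Y i \<in> vec.span {phi (X ^ d)}" if "i \<le> d" for i
    proof (cases "i = 0")
      case True
      have "Q (r + 0) *v form X Y 0 = form X Y 0" using assms(1) by (auto simp: projects_def)
      with True show ?thesis by (simp add: fam_def form_def vec.span_base)
    next
      case False
      have "Q (r + 0) *v form X Y i = 0" using assms(1) that False by (auto simp: projects_def)
      then show ?thesis by (simp add: fam_def vector_scalar_commute vec.span_zero)
    qed
    ultimately show ?thesis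
      unfolding fam_transition[OF j assms(2,3)]
      by (auto simp: vector_scalar_commute matrix_vector_mult_sum
          intro!: vec.span_scale vec.span_sum)
  qed
  then have "Q r *v g \<in> vec.span {phi (X ^ d)}"
    using assms(4) unfolding string_span_def by (rule_tac span_mult_closed) auto
  then show ?thesis by (auto simp: vec.span_singleton)
qed

end

section \<open>Irreducible modules\<close>

lemma T_module_closed:
  assumes "T_module W" "g \<in> W"
  shows "adj_mat *v g \<in> W" "dual_adj_mat *v g \<in> W"
proof -
  have "adj_mat \<in> T_alg" "dual_adj_mat \<in> T_alg"
    unfolding T_alg_def by (simp_all add: hull_inc)
  with assms show "adj_mat *v g \<in> W" "dual_adj_mat *v g \<in> W"
    unfolding T_module_def image_space_def by blast+
qed

text \<open>The matrices that preserve \<open>U\<close> form a subalgebra, so it suffices to check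
  the generators.\<close>

lemma T_moduleI:
  assumes U: "vec.subspace U"
    and "\<And>g. g \<in> U \<Longrightarrow> adj_mat *v g \<in> U" "\<And>g. g \<in> U \<Longrightarrow> dual_adj_mat *v g \<in> U"
  shows "T_module U"
proof -
  let ?S = "{M. \<forall>g\<in>U. M *v g \<in> U}"
  have "subalgebra ?S"
    using U by (auto simp: subalgebra_def matrix_vector_mult_add_rdistrib vec.subspace_add
        vec.subspace_scale simp flip: matrix_vector_mul_assoc)
  then have "T_alg \<subseteq> ?S" unfolding T_alg_def using assms(2,3) by (intro hull_minimal) auto
  then show ?thesis using U by (auto simp: T_module_def image_space_def)
qed

text \<open>With A = up + down, the commutator of \<open>dual_adj_mat\<close> and A is 2 (up -
  down). Hence T-modules are closed under the raising and lowering operators.\<close>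

lemma up_eq:
  "up_mat *v g = (1 / 4) *s (2 *s (adj_mat *v g)
    + (dual_adj_mat *v (adj_mat *v g) - adj_mat *v (dual_adj_mat *v g)))"
  unfolding adj_mat_up_down matrix_vector_right_distrib dual_up dual_down
  by (simp add: vec_eq_iff)

lemma down_eq: "down_mat *v g = adj_mat *v g - up_mat *v g"
  by (simp add: adj_mat_up_down)

lemma E_star_closed:
  assumes "T_module W" "g \<in> W" "i \<le> CARD('n)"
  shows "E_star i *v (g :: 'n::finite cvec) \<in> W"
  unfolding E_star_eq_lagrange[OF assms(3)]
  using assms T_module_closed(2) by (intro lagrange_closed) (auto simp: T_module_def)

lemma endpoint_props:
  assumes "irreducible_T_module (W :: 'n::finite cvec set)" "endpoint W = r"
  shows "r \<le> CARD('n)" "\<And>i. i < r \<Longrightarrow> image_space (E_star i) W = {0}"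
proof -
  let ?S = "{i. i \<le> CARD('n) \<and> image_space (E_star i) W \<noteq> {0}}"
  have mod: "T_module W" "W \<noteq> {0}" using assms(1) by (auto simp: irreducible_T_module_def)
  then have "0 \<in> W" by (simp add: T_module_def vec.subspace_0)
  with mod obtain g where g: "g \<in> W" "g \<noteq> 0" by blast
  \<comment> \<open>The \<open>E_star i\<close> sum to the identity, so a nonzero vector has a
    nonzero component; \<open>Min\<close> is therefore attained.\<close>
  have "?S \<noteq> {}"
  proof
    assume "?S = {}"
    then have "E_star i *v g = 0" if "i \<le> CARD('n)" for i
      using that g(1) by (auto simp: image_space_def)
    then have "g = 0" using E_star_sum[of g] by simp
    with g show False by simp
  qed
  moreover have fin: "finite ?S" by simp
  ultimately have "Min ?S \<in> ?S" by (rule Min_in[rotated])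
  then show r: "r \<le> CARD('n)" using assms(2) by (simp add: endpoint_def)
  fix i assume "i < r"
  then have "i \<notin> ?S" using Min_le[OF fin, of i] assms(2) unfolding endpoint_def by linarith
  with \<open>i < r\<close> r show "image_space (E_star i) W = {0}" by simp
qed

text \<open>Raising would move \<open>v\<close> to index \<open>r - 1\<close>. For
  \<open>r = 0\<close> the value \<open>theta CARD('n) r + 2\<close> is not an eigenvalue; for
  \<open>r > 0\<close> minimality of the endpoint forbids a nonzero vector there.\<close>

lemma up_lowest:
  fixes W :: "'n::finite cvec set"
  assumes W: "irreducible_T_module W" "endpoint W = r"
    and v: "v \<in> W" "up_mat *v v \<in> W" "dual_adj_mat *v v = theta CARD('n) r *s v"
  shows "up_mat *v v = 0"
proof -
  have eig: "dual_adj_mat *v (up_mat *v v) = (theta CARD('n) r + 2) *s (up_mat *v v)"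
    unfolding dual_up v(3) by (simp add: vector_scalar_commute vec.scale_left_distrib)
  show ?thesis
  proof (cases r)
    case 0
    have "theta CARD('n) r + 2 \<noteq> theta CARD('n) i" for i
    proof
      assume "theta CARD('n) r + 2 = theta CARD('n) i"
      then have "2 * (of_nat (1 + i) :: complex) = 0" by (simp add: theta_def 0 algebra_simps)
      then have "(of_nat (1 + i) :: complex) = 0" by (simp only: mult_eq_0_iff) simp
      then show False by (simp only: of_nat_eq_0_iff)
    qed
    then show ?thesis by (rule dual_eigenvector_zero[OF eig])
  next
    case (Suc m)
    then have m: "m < r" "m \<le> CARD('n)" using endpoint_props(1)[OF W] by auto
    have "theta CARD('n) r + 2 = theta CARD('n) m" by (simp add: theta_def Suc)
    with eig have "E_star m *v (up_mat *v v) = up_mat *v v"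
      using E_star_eigenvector[OF _ m(2) m(2)] by simp
    then have "up_mat *v v \<in> image_space (E_star m) W"
      using v(2) by (metis image_space_def imageI)
    then show ?thesis using endpoint_props(2)[OF W m(1)] by simp
  qed
qed

text \<open>The usual \<open>sl2\<close> argument: the vectors obtained from \<open>v\<close> by
  repeated lowering span a submodule, which irreducibility makes equal to \<open>W\<close>.\<close>

lemma irreducible_weight_string:
  fixes W :: "'n::finite cvec set"
  assumes W: "irreducible_T_module W" "endpoint W = r" "module_diameter W = d"
    and v: "v \<in> image_space (E_star r) W" "v \<noteq> 0"
  shows "\<exists>w. weight_string d r w \<and> w 0 = v \<and> W = vec.span (w ` {..d})"
proof -
  let ?D = "CARD('n)"
  have mod: "T_module W" and irr: "\<And>U. T_module U \<Longrightarrow> U \<subseteq> W \<Longrightarrow> U = {0} \<or> U = W"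
    using W(1) by (auto simp: irreducible_T_module_def)
  then have sub: "vec.subspace W" by (simp add: T_module_def)
  have up: "up_mat *v g \<in> W" if "g \<in> W" for g
    unfolding up_eq using that T_module_closed[OF mod] sub
    by (intro vec.subspace_scale vec.subspace_add vec.subspace_diff) auto
  have down: "down_mat *v g \<in> W" if "g \<in> W" for g
    unfolding down_eq using that T_module_closed[OF mod] sub up by (intro vec.subspace_diff) auto
  have rD: "r \<le> ?D" by (rule endpoint_props(1)[OF W(1,2)])
  obtain g where g: "g \<in> W" "v = E_star r *v g" using v(1) by (auto simp: image_space_def)
  have vW: "v \<in> W" unfolding g(2) by (rule E_star_closed[OF mod g(1) rD])
  have dual_v: "dual_adj_mat *v v = theta ?D r *s v" unfolding g(2) by (rule dual_E_star)
  have up_v: "up_mat *v v = 0" using up_lowest[OF W(1,2) vW up[OF vW] dual_v] .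

  define y where "y k = ((\<lambda>g. down_mat *v g) ^^ k) v" for k
  have y_Suc: "y (Suc k) = down_mat *v y k" and y_0: "y 0 = v" for k by (simp_all add: y_def)
  have yW: "y k \<in> W" for k by (induction k) (simp_all add: y_Suc y_0 vW down)
  have dual_y: "dual_adj_mat *v y k = theta ?D (r + k) *s y k" for k
  proof (induction k)
    case 0
    show ?case by (simp add: y_0 dual_v)
  next
    case (Suc k)
    show ?case unfolding y_Suc dual_down Suc vector_scalar_commute
      by (simp add: vec_eq_iff theta_def algebra_simps)
  qed
  \<comment> \<open>By \<open>up_down\<close> each step adds the weight
    \<open>theta ?D (r + k)\<close>; the weights up to index \<open>k\<close> sum to
    \<open>(k + 1) (theta ?D r - k)\<close>.\<close>
  have up_y: "up_mat *v y (Suc k) = (of_nat (Suc k) * (theta ?D r - of_nat k)) *s y k" for k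
  proof (induction k)
    case 0
    show ?case unfolding y_Suc up_down by (simp add: y_0 up_v dual_v)
  next
    case (Suc k)
    have "up_mat *v y (Suc (Suc k))
      = (of_nat (Suc k) * (theta ?D r - of_nat k)) *s y (Suc k) + theta ?D (r + Suc k) *s y (Suc k)"
      unfolding y_Suc[of "Suc k"] up_down dual_y Suc by (simp add: vector_scalar_commute y_Suc)
    also have "\<dots> = (of_nat (Suc (Suc k)) * (theta ?D r - of_nat (Suc k))) *s y (Suc k)"
      unfolding vec.scale_left_distrib[symmetric]
      by (rule arg_cong[where f = "\<lambda>c. c *s y (Suc k)"]) (simp add: theta_def algebra_simps)
    finally show ?case .
  qed
  \<comment> \<open>Its index \<open>r + ?D + 1\<close> lies beyond the eigenvalues of
    \<open>dual_adj_mat\<close>.\<close>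
  have "y (Suc ?D) = 0"
    by (rule dual_eigenvector_zero[OF dual_y]) (simp add: theta_inj)
  define e where "e = (LEAST k. y (Suc k) = 0)"
  have y_e: "y (Suc e) = 0" unfolding e_def using \<open>y (Suc ?D) = 0\<close> by (rule LeastI)
  have y_nz: "y k \<noteq> 0" if "k \<le> e" for k
  proof (cases k)
    case 0
    then show ?thesis using v by (simp add: y_0)
  next
    case (Suc l)
    then have "l < e" using that by simp
    then show ?thesis using not_less_Least[of l "\<lambda>k. y (Suc k) = 0"] unfolding e_def Suc by auto
  qed
  \<comment> \<open>Raising \<open>y (Suc e) = 0\<close> gives a multiple of the nonzero
    \<open>y e\<close>, which forces \<open>theta ?D r = e\<close> and so determines the length of
    the string.\<close>
  have "(of_nat (Suc e) * (theta ?D r - of_nat e)) *s y e = 0"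
    unfolding up_y[symmetric] y_e by simp
  then have "theta ?D r = of_nat e" using y_nz[of e] by (simp del: of_nat_Suc)
  then have "(of_nat (e + 2 * r) :: complex) = of_nat ?D" by (simp add: theta_def algebra_simps)
  then have card: "e + 2 * r = ?D" by (simp only: of_nat_eq_iff)

  \<comment> \<open>The factorials change the lowering coefficient from 1 to \<open>e - k\<close>
    and the raising coefficient to \<open>k\<close>, as for monomials.\<close>
  define w where "w k = (fact (e - k) / fact e :: complex) *s y k" for k
  have ws: "weight_string e r w"
  proof
    show "e + 2 * r = ?D" by (rule card)
  next
    fix k assume k: "k \<le> e"
    show "up_mat *v w k = of_nat k *s w (k - 1)"
    proof (cases k)
      case 0
      then show ?thesis by (simp add: w_def vector_scalar_commute y_0 up_v)
    next
      case (Suc l)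
      have "fact (e - l) = (of_nat (e - l) * fact (e - k) :: complex)"
        using k Suc by (metis Suc_diff_Suc Suc_le_eq fact_Suc of_nat_mult of_nat_fact)
      moreover have "(of_nat (e - l) :: complex) = of_nat e - of_nat l"
        using k Suc by (simp add: of_nat_diff)
      ultimately show ?thesis unfolding w_def vector_scalar_commute Suc up_y \<open>theta ?D r = of_nat e\<close>
        by (simp add: vector_smult_assoc mult_ac)
    qed
    show "down_mat *v w k = (of_nat e - of_nat k) *s w (Suc k)"
    proof (cases "k = e")
      case True
      then show ?thesis by (simp add: w_def vector_scalar_commute flip: y_Suc) (simp add: y_e)
    next
      case False
      then have "fact (e - k) = (of_nat (e - k) * fact (e - Suc k) :: complex)"
        using k by (metis Suc_diff_Suc fact_Suc le_neq_implies_less of_nat_mult of_nat_fact)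
      moreover have "(of_nat (e - k) :: complex) = of_nat e - of_nat k"
        using k by (simp add: of_nat_diff)
      ultimately show ?thesis unfolding w_def vector_scalar_commute y_Suc[symmetric]
        by (simp add: vector_smult_assoc mult_ac del: vector_sub_rdistrib)
    qed
    show "dual_adj_mat *v w k = theta ?D (r + k) *s w k"
      by (simp add: w_def vector_scalar_commute dual_y vector_smult_assoc mult_ac)
    show "w k \<noteq> 0" using y_nz[OF k] by (simp add: w_def)
  qed
  then interpret weight_string e r w .
  have w_0: "w 0 = v" by (simp add: w_def y_0)
  let ?U = "vec.span (w ` {..e})"
  have "T_module ?U"
  proof (rule T_moduleI)
    have up_U: "up_mat *v g \<in> ?U" and down_U: "down_mat *v g \<in> ?U" if "g \<in> ?U" for g
    proof -
      have "up_mat *v w k \<in> ?U" if "k \<le> e" for k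
        unfolding up_w[OF that] using that by (intro vec.span_scale vec.span_base) auto
      then show "up_mat *v g \<in> ?U" by (intro span_mult_closed[OF that]) auto
      have "down_mat *v w k \<in> ?U" if "k \<le> e" for k
      proof (cases "k = e")
        case True
        then show ?thesis by (simp add: down_w vec.span_zero)
      next
        case False
        then show ?thesis using that unfolding down_w[OF that]
          by (intro vec.span_scale vec.span_base) auto
      qed
      then show "down_mat *v g \<in> ?U" by (intro span_mult_closed[OF that]) auto
    qed
    show "adj_mat *v g \<in> ?U" if "g \<in> ?U" for g
      unfolding adj_mat_up_down using that by (intro vec.span_add up_U down_U)
    show "dual_adj_mat *v g \<in> ?U" if "g \<in> ?U" for g
    proof -
      have "dual_adj_mat *v w k \<in> ?U" if "k \<le> e" for k
        unfolding dual_w[OF that] using that by (intro vec.span_scale vec.span_base) auto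
      then show ?thesis by (intro span_mult_closed[OF that]) auto
    qed
  qed simp
  moreover have "?U \<subseteq> W"
    using yW sub by (intro vec.span_minimal) (auto simp: w_def intro: vec.subspace_scale)
  moreover have "v \<in> ?U" unfolding w_0[symmetric] by (intro vec.span_base) auto
  ultimately have UW: "W = ?U" using irr[of ?U] v(2) by auto
  \<comment> \<open>The weights occurring in \<open>W\<close> are those of the string; counting them
    identifies \<open>e\<close> with the diameter.\<close>
  have "{i. i \<le> ?D \<and> image_space (E_star i) W \<noteq> {0}} = {r..r + e}"
  proof (intro equalityI subsetI)
    fix i assume i: "i \<in> {i. i \<le> ?D \<and> image_space (E_star i) W \<noteq> {0}}"
    show "i \<in> {r..r + e}"
    proof (rule ccontr)
      assume "i \<notin> {r..r + e}"
      then have "E_star i *v w k = 0" if "k \<le> e" for k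
        using E_star_eigenvector[OF dual_w[OF that], of i] i card that by auto
      then have "E_star i *v g = 0" if "g \<in> W" for g
        using span_mult_closed[of g "w ` {..e}" "E_star i" "{}"] that UW by auto
      moreover have "0 \<in> W" using sub by (rule vec.subspace_0)
      ultimately have "image_space (E_star i) W = {0}" unfolding image_space_def by force
      with i show False by simp
    qed
  next
    fix i assume "i \<in> {r..r + e}"
    then obtain k where k: "i = r + k" "k \<le> e" by (metis atLeastAtMost_iff le_Suc_ex nat_add_left_cancel_le)
    have "w k \<in> W" unfolding UW using k by (intro vec.span_base) auto
    moreover have "E_star i *v w k = w k" using k E_star_w by simp
    ultimately have "w k \<in> image_space (E_star i) W" unfolding image_space_def by (metis imageI)
    then show "i \<in> {i. i \<le> ?D \<and> image_space (E_star i) W \<noteq> {0}}"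
      using w_nonzero[OF k(2)] k card by auto
  qed
  then have "d = e" using W(3) by (simp add: module_diameter_def)
  with ws w_0 UW show ?thesis by blast
qed

section \<open>The transition matrices\<close>

lemma i_powi_minus: "\<i> powi (- int n) = (- \<i>) ^ n"
  by (simp add: power_int_minus power_inverse[symmetric])

lemma i_powi_minus_diff: "\<i> powi (- int n - int m) = (- \<i>) ^ n * (- \<i>) ^ m"
  using power_int_add[of \<i> "- int n" "- int m"] by (simp add: i_powi_minus)

theorem theorem13p1:
  fixes W :: "'n::finite cvec set"
    and u us ue :: "'n cvec"
    and r d :: nat
    and B :: "nat \<Rightarrow> nat \<Rightarrow> 'n cvec"
  assumes "irreducible_T_module W"
    and "endpoint W = r"
    and "module_diameter W = d"
    and "u \<in> image_space (E r) W" and "u \<noteq> 0"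
    and "us \<in> image_space (E_star r) W" and "us \<noteq> 0"
    and "ue \<in> image_space (E_eps r) W" and "ue \<noteq> 0"
    and "B 1 = (\<lambda>i. E_star (r + i) *v u)"
    and "B 2 = (\<lambda>i. E_eps (r + i) *v u)"
    and "B 3 = (\<lambda>i. E_eps (r + i) *v us)"
    and "B 4 = (\<lambda>i. E (r + i) *v us)"
    and "B 5 = (\<lambda>i. E (r + i) *v ue)"
    and "B 6 = (\<lambda>i. E_star (r + i) *v ue)"
  shows "d + 2 * r = CARD('n) \<and>
     (\<forall>k\<in>{1..6}. is_transition_matrix W d (B k) (B k) (diag (\<lambda>_. 1))) \<and>
     is_transition_matrix W d (B 1) (B 2) (\<lambda>i j. 1 / (1 - \<i>) ^ d * (\<i> powi (- int i - int j) * Phi d i j)) \<and>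
     is_transition_matrix W d (B 1) (B 3) (\<lambda>i j. cinner us u / cnorm_sq u * (\<i> powi (- int i) * Phi d i j)) \<and>
     is_transition_matrix W d (B 1) (B 4) (\<lambda>i j. cinner us u / cnorm_sq u * Phi d i j) \<and>
     is_transition_matrix W d (B 1) (B 5) (\<lambda>i j. cinner ue u / cnorm_sq u * (\<i> ^ j * Phi d i j)) \<and>
     is_transition_matrix W d (B 1) (B 6) (\<lambda>i j. (1 + \<i>) ^ d * cinner ue u / cnorm_sq u * D2 i j) \<and>
     is_transition_matrix W d (B 2) (B 1) (\<lambda>i j. 1 / (1 + \<i>) ^ d * (\<i> ^ (i + j) * Phi d i j)) \<and>
     is_transition_matrix W d (B 2) (B 3) (\<lambda>i j. (1 - \<i>) ^ d * cinner us u / cnorm_sq u * D1 i j) \<and>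
     is_transition_matrix W d (B 2) (B 4) (\<lambda>i j. cinner us u / cnorm_sq u * (\<i> powi (- int j) * Phi d i j)) \<and>
     is_transition_matrix W d (B 2) (B 5) (\<lambda>i j. cinner ue u / cnorm_sq u * Phi d i j) \<and>
     is_transition_matrix W d (B 2) (B 6) (\<lambda>i j. cinner ue u / cnorm_sq u * (\<i> ^ i * Phi d i j)) \<and>
     is_transition_matrix W d (B 3) (B 1) (\<lambda>i j. cinner u us / cnorm_sq us * (\<i> ^ j * Phi d i j)) \<and>
     is_transition_matrix W d (B 3) (B 2) (\<lambda>i j. (1 + \<i>) ^ d * cinner u us / cnorm_sq us * D2 i j) \<and>
     is_transition_matrix W d (B 3) (B 4) (\<lambda>i j. 1 / (1 - \<i>) ^ d * (\<i> powi (- int i - int j) * Phi d i j)) \<and>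
     is_transition_matrix W d (B 3) (B 5) (\<lambda>i j. cinner ue us / cnorm_sq us * (\<i> powi (- int i) * Phi d i j)) \<and>
     is_transition_matrix W d (B 3) (B 6) (\<lambda>i j. cinner ue us / cnorm_sq us * Phi d i j) \<and>
     is_transition_matrix W d (B 4) (B 1) (\<lambda>i j. cinner u us / cnorm_sq us * Phi d i j) \<and>
     is_transition_matrix W d (B 4) (B 2) (\<lambda>i j. cinner u us / cnorm_sq us * (\<i> ^ i * Phi d i j)) \<and>
     is_transition_matrix W d (B 4) (B 3) (\<lambda>i j. 1 / (1 + \<i>) ^ d * (\<i> ^ (i + j) * Phi d i j)) \<and>
     is_transition_matrix W d (B 4) (B 5) (\<lambda>i j. (1 - \<i>) ^ d * cinner ue us / cnorm_sq us * D1 i j) \<and>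
     is_transition_matrix W d (B 4) (B 6) (\<lambda>i j. cinner ue us / cnorm_sq us * (\<i> powi (- int j) * Phi d i j)) \<and>
     is_transition_matrix W d (B 5) (B 1) (\<lambda>i j. cinner u ue / cnorm_sq ue * (\<i> powi (- int i) * Phi d i j)) \<and>
     is_transition_matrix W d (B 5) (B 2) (\<lambda>i j. cinner u ue / cnorm_sq ue * Phi d i j) \<and>
     is_transition_matrix W d (B 5) (B 3) (\<lambda>i j. cinner us ue / cnorm_sq ue * (\<i> ^ j * Phi d i j)) \<and>
     is_transition_matrix W d (B 5) (B 4) (\<lambda>i j. (1 + \<i>) ^ d * cinner us ue / cnorm_sq ue * D2 i j) \<and>
     is_transition_matrix W d (B 5) (B 6) (\<lambda>i j. 1 / (1 - \<i>) ^ d * (\<i> powi (- int i - int j) * Phi d i j)) \<and>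
     is_transition_matrix W d (B 6) (B 1) (\<lambda>i j. (1 - \<i>) ^ d * cinner u ue / cnorm_sq ue * D1 i j) \<and>
     is_transition_matrix W d (B 6) (B 2) (\<lambda>i j. cinner u ue / cnorm_sq ue * (\<i> powi (- int j) * Phi d i j)) \<and>
     is_transition_matrix W d (B 6) (B 3) (\<lambda>i j. cinner us ue / cnorm_sq ue * Phi d i j) \<and>
     is_transition_matrix W d (B 6) (B 4) (\<lambda>i j. cinner us ue / cnorm_sq ue * (\<i> ^ i * Phi d i j)) \<and>
     is_transition_matrix W d (B 6) (B 5) (\<lambda>i j. 1 / (1 + \<i>) ^ d * (\<i> ^ (i + j) * Phi d i j))"
proof -
  obtain w where w: "weight_string d r w" "w 0 = us" "W = vec.span (w ` {..d})"
    using irreducible_weight_string[OF assms(1-3,6,7)] by blast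
  interpret weight_string d r w by (rule w(1))
  have W: "W = string_span" unfolding string_span_def by (rule w(3))
  have us: "us = 1 *s phi (1 ^ d)" using fam_std[of 0] by (simp add: fam_0 w(2))
  obtain gu where "gu \<in> W" "u = E r *v gu" using assms(4) by (auto simp: image_space_def)
  \<comment> \<open>The parameters \<open>1 / 2\<close>, \<open>1\<close>, \<open>1\<close> encode
    \<open>1 = ((1 + t) + (1 - t)) / 2\<close> and \<open>t = ((1 + t) - (1 - t)) / 2\<close>. For
    \<open>ue\<close> below, the last one is \<open>\<i>\<close>, since
    \<open>t = \<i> ((1 - \<i> t) - (1 + \<i> t)) / 2\<close>.\<close>
  then obtain a where u: "u = a *s phi ([:1, 1:] ^ d)"
    using projects_span[OF projects_E, of "1 / 2" 1 1 gu] by (auto simp: W one_pCons)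
  obtain ge where "ge \<in> W" "ue = E_eps r *v ge" using assms(8) by (auto simp: image_space_def)
  then obtain b where ue: "ue = b *s phi ([:1, - \<i>:] ^ d)"
    using projects_span[OF projects_eps, of "1 / 2" 1 \<i> ge] by (auto simp: W one_pCons)
  have ab: "a \<noteq> 0" "b \<noteq> 0" using u ue assms(5,9) by auto

  \<comment> \<open>These rescaled second forms serve \<open>B 2\<close>, \<open>B 5\<close> and
    \<open>B 6\<close>; with them the proportionalities \<open>Z2\<close>, \<open>Z5\<close> and
    \<open>Z6\<close> hold.\<close>
  have Y2: "smult (- \<i>) [:1, \<i>:] = [:- \<i>, 1:]" and Y5: "smult \<i> [:1, - 1:] = [:\<i>, - \<i>:]"
    and Y6: "smult (- \<i>) [:0, 1:] = [:0, - \<i>:]" by simp_all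
  note pr2 = projects_smult[OF projects_eps, of "- \<i>", unfolded Y2]
    and pr5 = projects_smult[OF projects_E, of \<i>, unfolded Y5]
    and pr6 = projects_smult[OF projects_star, of "- \<i>", unfolded Y6]
    and eig2 = eigenforms_smult[OF eigenforms_eps, of "- \<i>", unfolded Y2]
    and eig5 = eigenforms_smult[OF eigenforms_adj, of \<i>, unfolded Y5]
    and eig6 = eigenforms_smult[OF eigenforms_star, of "- \<i>", unfolded Y6]
  have Z1: "[:1, 1:] = smult 1 (1 + [:0, 1 :: complex:])"
    and Z2: "[:1, 1:] = smult ((1 + \<i>) / 2) ([:1, - \<i>:] + [:- \<i>, 1:])"
    and Z3: "1 = smult (1 / 2) ([:1, - \<i>:] + [:1, \<i>:])"
    and Z4: "1 = smult (1 / 2) ([:1, 1:] + [:1, - 1 :: complex:])"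
    and Z5: "[:1, - \<i>:] = smult ((1 - \<i>) / 2) ([:1, 1:] + [:\<i>, - \<i>:])"
    and Z6: "[:1, - \<i>:] = smult 1 (1 + [:0, - \<i>:])"
    by (simp_all add: one_pCons complex_eq_iff)

  \<comment> \<open>Since \<open>(1 + \<i>) (1 - \<i>) = 2\<close>, the powers of
    \<open>1 / 2\<close>, \<open>(1 + \<i>) / 2\<close> and \<open>(1 - \<i>) / 2\<close> become
    \<open>1 / (G * H)\<close>, \<open>1 / G\<close> and \<open>1 / H\<close>.\<close>
  define G H where "G = (1 - \<i>) ^ d" and "H = (1 + \<i>) ^ d"
  have GH: "(2 :: complex) ^ d = H * G"
    unfolding G_def H_def power_mult_distrib[symmetric] by (simp add: algebra_simps)
  then have GH_nz: "G \<noteq> 0" "H \<noteq> 0" by auto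
  note scal = power_divide GH G_def[symmetric] H_def[symmetric]

  have "B 1 i = a *s fam 1 [:0, 1:] i" if "i \<le> d" for i
    using projects_phi_power[OF projects_star Z1 that]
    unfolding assms(10) u vector_scalar_commute by simp
  note B1 = this
  have "B 2 i = (a / G) *s fam [:1, - \<i>:] [:- \<i>, 1:] i" if "i \<le> d" for i
    using projects_phi_power[OF pr2 Z2 that] GH_nz
    by (simp add: assms(11) u vector_scalar_commute vector_smult_assoc scal)
  note B2 = this
  have "B 3 i = (1 / (G * H)) *s fam [:1, - \<i>:] [:1, \<i>:] i" if "i \<le> d" for i
    using projects_phi_power[OF projects_eps Z3 that]
    by (simp add: assms(12) us vector_scalar_commute vector_smult_assoc scal mult.commute)
  note B3 = this
  have "B 4 i = (1 / (G * H)) *s fam [:1, 1:] [:1, - 1:] i" if "i \<le> d" for i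
    using projects_phi_power[OF projects_E Z4 that]
    by (simp add: assms(13) us vector_scalar_commute vector_smult_assoc scal mult.commute)
  note B4 = this
  have "B 5 i = (b / H) *s fam [:1, 1:] [:\<i>, - \<i>:] i" if "i \<le> d" for i
    using projects_phi_power[OF pr5 Z5 that] GH_nz
    by (simp add: assms(14) ue vector_scalar_commute vector_smult_assoc scal)
  note B5 = this
  have "B 6 i = b *s fam 1 [:0, - \<i>:] i" if "i \<le> d" for i
    using projects_phi_power[OF pr6 Z6 that]
    by (simp add: assms(15) ue vector_scalar_commute vector_smult_assoc)
  note B6 = this

  \<comment> \<open>Each pair occurs in both orders, each time expanded in the eigenvectors
    belonging to the second argument. All prefactors thereby become expressions in \<open>a\<close>,
    \<open>b\<close>, \<open>G\<close> and \<open>H\<close>.\<close>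
  have inner: "cinner us u = 1 / (G * H * a) * cnorm_sq u" "cinner ue u = b / (H * a) * cnorm_sq u"
    "cinner u us = a * cnorm_sq us" "cinner ue us = b * cnorm_sq us"
    "cinner u ue = a / (G * b) * cnorm_sq ue" "cinner us ue = 1 / (G * H * b) * cnorm_sq ue"
    using cinner_phi_power[OF eigenforms_adj hermitian_adj Z4 ab(1) us u]
      cinner_phi_power[OF eig5 hermitian_adj Z5 ab(1) ue u]
      cinner_phi_power[OF eigenforms_star hermitian_dual Z1 one_neq_zero u us]
      cinner_phi_power[OF eig6 hermitian_dual Z6 one_neq_zero ue us]
      cinner_phi_power[OF eig2 hermitian_eps Z2 ab(2) u ue]
      cinner_phi_power[OF eigenforms_eps hermitian_eps Z3 ab(2) us ue] GH_nz
    by (simp_all add: scal mult_ac)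
  note nz = ab GH_nz cnorm_sq_nonzero[OF assms(5)] cnorm_sq_nonzero[OF assms(7)] cnorm_sq_nonzero[OF assms(9)]

  note entries = i_powi_minus i_powi_minus_diff D1_def D2_def power_add power_one mult_1_left mult_1_right mult_ac

  \<comment> \<open>In each case \<open>m\<close>, \<open>s\<close> and \<open>t\<close> solve
    \<open>X' = m (X + s Y)\<close> and \<open>Y' = m t (X - s Y)\<close> for the forms of the two
    bases, and \<open>\<kappa>\<close> is the stated prefactor. What remains are these polynomial
    identities, the scalar equation for \<open>\<kappa>\<close>, and the shape of the
    entries.\<close>
  have T12: "\<forall>j\<le>d. B 2 j = 
      (\<Sum>i\<le>d. (1 / (1 - \<i>) ^ d * (\<i> powi (- int i - int j) * Phi d i j)) *s B 1 i)"
    by (rule transition[OF B1 B2, where m = "1" and s = "(- \<i>)" and t = "(- \<i>)" and \<kappa> = "1 / (1 - \<i>) ^ d"];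
      (simp add: one_pCons complex_eq_iff; fail | simp only: entries; fail
        | simp only: inner scal, simp add: nz field_simps; fail))
  have T13: "\<forall>j\<le>d. B 3 j = 
      (\<Sum>i\<le>d. (cinner us u / cnorm_sq u * (\<i> powi (- int i) * Phi d i j)) *s B 1 i)"
    by (rule transition[OF B1 B3, where m = "1" and s = "(- \<i>)" and t = "1" and \<kappa> = "cinner us u / cnorm_sq u"];
      (simp add: one_pCons complex_eq_iff; fail | simp only: entries; fail
        | simp only: inner scal, simp add: nz field_simps; fail))
  have T14: "\<forall>j\<le>d. B 4 j = 
      (\<Sum>i\<le>d. (cinner us u / cnorm_sq u * Phi d i j) *s B 1 i)"
    by (rule transition[OF B1 B4, where m = "1" and s = "1" and t = "1" and \<kappa> = "cinner us u / cnorm_sq u"];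
      (simp add: one_pCons complex_eq_iff; fail | simp only: entries; fail
        | simp only: inner scal, simp add: nz field_simps; fail))
  have T15: "\<forall>j\<le>d. B 5 j = 
      (\<Sum>i\<le>d. (cinner ue u / cnorm_sq u * (\<i> ^ j * Phi d i j)) *s B 1 i)"
    by (rule transition[OF B1 B5, where m = "1" and s = "1" and t = "\<i>" and \<kappa> = "cinner ue u / cnorm_sq u"];
      (simp add: one_pCons complex_eq_iff; fail | simp only: entries; fail
        | simp only: inner scal, simp add: nz field_simps; fail))
  \<comment> \<open>\<open>B 1\<close> and \<open>B 6\<close> both come from \<open>E_star\<close>,
    hence a diagonal matrix; likewise \<open>B 2\<close> and \<open>B 3\<close> from
    \<open>E_eps\<close>, and \<open>B 4\<close> and \<open>B 5\<close> from
    \<open>E\<close>.\<close>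
  have T16: "\<forall>j\<le>d. B 6 j = 
      (\<Sum>i\<le>d. ((1 + \<i>) ^ d * cinner ue u / cnorm_sq u * D2 i j) *s B 1 i)"
    by (rule transition_diag[OF B1 B6, where m = "1" and s = "(- \<i>)" and \<kappa> = "(1 + \<i>) ^ d * cinner ue u / cnorm_sq u"];
      (simp add: one_pCons complex_eq_iff; fail | simp only: entries; fail
        | simp only: inner scal, simp add: nz field_simps; fail))
  have T21: "\<forall>j\<le>d. B 1 j = 
      (\<Sum>i\<le>d. (1 / (1 + \<i>) ^ d * (\<i> ^ (i + j) * Phi d i j)) *s B 2 i)"
    by (rule transition[OF B2 B1, where m = "(1 / 2)" and s = "\<i>" and t = "\<i>" and \<kappa> = "1 / (1 + \<i>) ^ d"];
      (simp add: one_pCons complex_eq_iff; fail | simp only: entries; fail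
        | simp only: inner scal, simp add: nz field_simps; fail))
  have T23: "\<forall>j\<le>d. B 3 j = 
      (\<Sum>i\<le>d. ((1 - \<i>) ^ d * cinner us u / cnorm_sq u * D1 i j) *s B 2 i)"
    by (rule transition_diag[OF B2 B3, where m = "1" and s = "\<i>" and \<kappa> = "(1 - \<i>) ^ d * cinner us u / cnorm_sq u"];
      (simp add: one_pCons complex_eq_iff; fail | simp only: entries; fail
        | simp only: inner scal, simp add: nz field_simps; fail))
  have T24: "\<forall>j\<le>d. B 4 j = 
      (\<Sum>i\<le>d. (cinner us u / cnorm_sq u * (\<i> powi (- int j) * Phi d i j)) *s B 2 i)"
    by (rule transition[OF B2 B4, where m = "((1 + \<i>) / 2)" and s = "1" and t = "(- \<i>)" and \<kappa> = "cinner us u / cnorm_sq u"];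
      (simp add: one_pCons complex_eq_iff; fail | simp only: entries; fail
        | simp only: inner scal, simp add: nz field_simps; fail))
  have T25: "\<forall>j\<le>d. B 5 j = 
      (\<Sum>i\<le>d. (cinner ue u / cnorm_sq u * Phi d i j) *s B 2 i)"
    by (rule transition[OF B2 B5, where m = "((1 + \<i>) / 2)" and s = "1" and t = "1" and \<kappa> = "cinner ue u / cnorm_sq u"];
      (simp add: one_pCons complex_eq_iff; fail | simp only: entries; fail
        | simp only: inner scal, simp add: nz field_simps; fail))
  have T26: "\<forall>j\<le>d. B 6 j = 
      (\<Sum>i\<le>d. (cinner ue u / cnorm_sq u * (\<i> ^ i * Phi d i j)) *s B 2 i)"
    by (rule transition[OF B2 B6, where m = "(1 / 2)" and s = "\<i>" and t = "1" and \<kappa> = "cinner ue u / cnorm_sq u"];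
      (simp add: one_pCons complex_eq_iff; fail | simp only: entries; fail
        | simp only: inner scal, simp add: nz field_simps; fail))
  have T31: "\<forall>j\<le>d. B 1 j = 
      (\<Sum>i\<le>d. (cinner u us / cnorm_sq us * (\<i> ^ j * Phi d i j)) *s B 3 i)"
    by (rule transition[OF B3 B1, where m = "(1 / 2)" and s = "1" and t = "\<i>" and \<kappa> = "cinner u us / cnorm_sq us"];
      (simp add: one_pCons complex_eq_iff; fail | simp only: entries; fail
        | simp only: inner scal, simp add: nz field_simps; fail))
  have T32: "\<forall>j\<le>d. B 2 j = 
      (\<Sum>i\<le>d. ((1 + \<i>) ^ d * cinner u us / cnorm_sq us * D2 i j) *s B 3 i)"
    by (rule transition_diag[OF B3 B2, where m = "1" and s = "(- \<i>)" and \<kappa> = "(1 + \<i>) ^ d * cinner u us / cnorm_sq us"];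
      (simp add: one_pCons complex_eq_iff; fail | simp only: entries; fail
        | simp only: inner scal, simp add: nz field_simps; fail))
  have T34: "\<forall>j\<le>d. B 4 j = 
      (\<Sum>i\<le>d. (1 / (1 - \<i>) ^ d * (\<i> powi (- int i - int j) * Phi d i j)) *s B 3 i)"
    by (rule transition[OF B3 B4, where m = "((1 + \<i>) / 2)" and s = "(- \<i>)" and t = "(- \<i>)" and \<kappa> = "1 / (1 - \<i>) ^ d"];
      (simp add: one_pCons complex_eq_iff; fail | simp only: entries; fail
        | simp only: inner scal, simp add: nz field_simps; fail))
  have T35: "\<forall>j\<le>d. B 5 j = 
      (\<Sum>i\<le>d. (cinner ue us / cnorm_sq us * (\<i> powi (- int i) * Phi d i j)) *s B 3 i)"
    by (rule transition[OF B3 B5, where m = "((1 + \<i>) / 2)" and s = "(- \<i>)" and t = "1" and \<kappa> = "cinner ue us / cnorm_sq us"];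
      (simp add: one_pCons complex_eq_iff; fail | simp only: entries; fail
        | simp only: inner scal, simp add: nz field_simps; fail))
  have T36: "\<forall>j\<le>d. B 6 j = 
      (\<Sum>i\<le>d. (cinner ue us / cnorm_sq us * Phi d i j) *s B 3 i)"
    by (rule transition[OF B3 B6, where m = "(1 / 2)" and s = "1" and t = "1" and \<kappa> = "cinner ue us / cnorm_sq us"];
      (simp add: one_pCons complex_eq_iff; fail | simp only: entries; fail
        | simp only: inner scal, simp add: nz field_simps; fail))
  have T41: "\<forall>j\<le>d. B 1 j = 
      (\<Sum>i\<le>d. (cinner u us / cnorm_sq us * Phi d i j) *s B 4 i)"
    by (rule transition[OF B4 B1, where m = "(1 / 2)" and s = "1" and t = "1" and \<kappa> = "cinner u us / cnorm_sq us"];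
      (simp add: one_pCons complex_eq_iff; fail | simp only: entries; fail
        | simp only: inner scal, simp add: nz field_simps; fail))
  have T42: "\<forall>j\<le>d. B 2 j = 
      (\<Sum>i\<le>d. (cinner u us / cnorm_sq us * (\<i> ^ i * Phi d i j)) *s B 4 i)"
    by (rule transition[OF B4 B2, where m = "((1 - \<i>) / 2)" and s = "\<i>" and t = "1" and \<kappa> = "cinner u us / cnorm_sq us"];
      (simp add: one_pCons complex_eq_iff; fail | simp only: entries; fail
        | simp only: inner scal, simp add: nz field_simps; fail))
  have T43: "\<forall>j\<le>d. B 3 j = 
      (\<Sum>i\<le>d. (1 / (1 + \<i>) ^ d * (\<i> ^ (i + j) * Phi d i j)) *s B 4 i)"
    by (rule transition[OF B4 B3, where m = "((1 - \<i>) / 2)" and s = "\<i>" and t = "\<i>" and \<kappa> = "1 / (1 + \<i>) ^ d"];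
      (simp add: one_pCons complex_eq_iff; fail | simp only: entries; fail
        | simp only: inner scal, simp add: nz field_simps; fail))
  have T45: "\<forall>j\<le>d. B 5 j = 
      (\<Sum>i\<le>d. ((1 - \<i>) ^ d * cinner ue us / cnorm_sq us * D1 i j) *s B 4 i)"
    by (rule transition_diag[OF B4 B5, where m = "1" and s = "\<i>" and \<kappa> = "(1 - \<i>) ^ d * cinner ue us / cnorm_sq us"];
      (simp add: one_pCons complex_eq_iff; fail | simp only: entries; fail
        | simp only: inner scal, simp add: nz field_simps; fail))
  have T46: "\<forall>j\<le>d. B 6 j = 
      (\<Sum>i\<le>d. (cinner ue us / cnorm_sq us * (\<i> powi (- int j) * Phi d i j)) *s B 4 i)"
    by (rule transition[OF B4 B6, where m = "(1 / 2)" and s = "1" and t = "(- \<i>)" and \<kappa> = "cinner ue us / cnorm_sq us"];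
      (simp add: one_pCons complex_eq_iff; fail | simp only: entries; fail
        | simp only: inner scal, simp add: nz field_simps; fail))
  have T51: "\<forall>j\<le>d. B 1 j = 
      (\<Sum>i\<le>d. (cinner u ue / cnorm_sq ue * (\<i> powi (- int i) * Phi d i j)) *s B 5 i)"
    by (rule transition[OF B5 B1, where m = "(1 / 2)" and s = "(- \<i>)" and t = "1" and \<kappa> = "cinner u ue / cnorm_sq ue"];
      (simp add: one_pCons complex_eq_iff; fail | simp only: entries; fail
        | simp only: inner scal, simp add: nz field_simps; fail))
  have T52: "\<forall>j\<le>d. B 2 j = 
      (\<Sum>i\<le>d. (cinner u ue / cnorm_sq ue * Phi d i j) *s B 5 i)"
    by (rule transition[OF B5 B2, where m = "((1 - \<i>) / 2)" and s = "1" and t = "1" and \<kappa> = "cinner u ue / cnorm_sq ue"];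
      (simp add: one_pCons complex_eq_iff; fail | simp only: entries; fail
        | simp only: inner scal, simp add: nz field_simps; fail))
  have T53: "\<forall>j\<le>d. B 3 j = 
      (\<Sum>i\<le>d. (cinner us ue / cnorm_sq ue * (\<i> ^ j * Phi d i j)) *s B 5 i)"
    by (rule transition[OF B5 B3, where m = "((1 - \<i>) / 2)" and s = "1" and t = "\<i>" and \<kappa> = "cinner us ue / cnorm_sq ue"];
      (simp add: one_pCons complex_eq_iff; fail | simp only: entries; fail
        | simp only: inner scal, simp add: nz field_simps; fail))
  have T54: "\<forall>j\<le>d. B 4 j = 
      (\<Sum>i\<le>d. ((1 + \<i>) ^ d * cinner us ue / cnorm_sq ue * D2 i j) *s B 5 i)"
    by (rule transition_diag[OF B5 B4, where m = "1" and s = "(- \<i>)" and \<kappa> = "(1 + \<i>) ^ d * cinner us ue / cnorm_sq ue"];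
      (simp add: one_pCons complex_eq_iff; fail | simp only: entries; fail
        | simp only: inner scal, simp add: nz field_simps; fail))
  have T56: "\<forall>j\<le>d. B 6 j = 
      (\<Sum>i\<le>d. (1 / (1 - \<i>) ^ d * (\<i> powi (- int i - int j) * Phi d i j)) *s B 5 i)"
    by (rule transition[OF B5 B6, where m = "(1 / 2)" and s = "(- \<i>)" and t = "(- \<i>)" and \<kappa> = "1 / (1 - \<i>) ^ d"];
      (simp add: one_pCons complex_eq_iff; fail | simp only: entries; fail
        | simp only: inner scal, simp add: nz field_simps; fail))
  have T61: "\<forall>j\<le>d. B 1 j = 
      (\<Sum>i\<le>d. ((1 - \<i>) ^ d * cinner u ue / cnorm_sq ue * D1 i j) *s B 6 i)"
    by (rule transition_diag[OF B6 B1, where m = "1" and s = "\<i>" and \<kappa> = "(1 - \<i>) ^ d * cinner u ue / cnorm_sq ue"];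
      (simp add: one_pCons complex_eq_iff; fail | simp only: entries; fail
        | simp only: inner scal, simp add: nz field_simps; fail))
  have T62: "\<forall>j\<le>d. B 2 j = 
      (\<Sum>i\<le>d. (cinner u ue / cnorm_sq ue * (\<i> powi (- int j) * Phi d i j)) *s B 6 i)"
    by (rule transition[OF B6 B2, where m = "1" and s = "1" and t = "(- \<i>)" and \<kappa> = "cinner u ue / cnorm_sq ue"];
      (simp add: one_pCons complex_eq_iff; fail | simp only: entries; fail
        | simp only: inner scal, simp add: nz field_simps; fail))
  have T63: "\<forall>j\<le>d. B 3 j = 
      (\<Sum>i\<le>d. (cinner us ue / cnorm_sq ue * Phi d i j) *s B 6 i)"
    by (rule transition[OF B6 B3, where m = "1" and s = "1" and t = "1" and \<kappa> = "cinner us ue / cnorm_sq ue"];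
      (simp add: one_pCons complex_eq_iff; fail | simp only: entries; fail
        | simp only: inner scal, simp add: nz field_simps; fail))
  have T64: "\<forall>j\<le>d. B 4 j = 
      (\<Sum>i\<le>d. (cinner us ue / cnorm_sq ue * (\<i> ^ i * Phi d i j)) *s B 6 i)"
    by (rule transition[OF B6 B4, where m = "1" and s = "\<i>" and t = "1" and \<kappa> = "cinner us ue / cnorm_sq ue"];
      (simp add: one_pCons complex_eq_iff; fail | simp only: entries; fail
        | simp only: inner scal, simp add: nz field_simps; fail))
  have T65: "\<forall>j\<le>d. B 5 j = 
      (\<Sum>i\<le>d. (1 / (1 + \<i>) ^ d * (\<i> ^ (i + j) * Phi d i j)) *s B 6 i)"
    by (rule transition[OF B6 B5, where m = "1" and s = "\<i>" and t = "\<i>" and \<kappa> = "1 / (1 + \<i>) ^ d"];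
      (simp add: one_pCons complex_eq_iff; fail | simp only: entries; fail
        | simp only: inner scal, simp add: nz field_simps; fail))

  have T11: "\<forall>j\<le>d. B 1 j = 
      (\<Sum>i\<le>d. diag (\<lambda>_. 1) i j *s B 1 i)"
    by (rule transition_diag[OF B1 B1, where m = 1 and s = 1 and \<kappa> = 1]) simp_all
  \<comment> \<open>\<open>B 1\<close> consists of nonzero multiples of the \<open>w i\<close>, so a
    transition from \<open>B k\<close> back to \<open>B 1\<close> shows that \<open>B k\<close>
    spans. For \<open>k = 1\<close> this is \<open>T11\<close>.\<close>
  have basis: "is_basis W d (B k)"
    if "\<And>i. i \<le> d \<Longrightarrow> B k i = p *s fam X Y i" "\<forall>j\<le>d. B 1 j = (\<Sum>i\<le>d. C i j *s B k i)" for k p X Y C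
    unfolding W
  proof (rule is_basisI[OF _ _ ab(1)])
    show "B k i \<in> string_span" if "i \<le> d" for i
      unfolding \<open>\<And>i. i \<le> d \<Longrightarrow> B k i = p *s fam X Y i\<close>[OF that] string_span_def
      using fam_in_span unfolding string_span_def by (rule vec.span_scale)
    show "\<forall>j\<le>d. a *s fam 1 [:0, 1:] j = (\<Sum>i\<le>d. C i j *s B k i)"
      using that(2) B1 by simp
  qed
  note bases = basis[OF B1 T11] basis[OF B2 T21] basis[OF B3 T31] basis[OF B4 T41]
    basis[OF B5 T51] basis[OF B6 T61]
  have identity: "is_transition_matrix W d (B k) (B k) (diag (\<lambda>_. 1))" if "k \<in> {1..6}" for k
  proof -
    have "k \<in> {1, 2, 3, 4, 5, 6}" using that by auto
    then have "is_basis W d (B k)" using bases by auto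
    moreover have "(\<Sum>i\<le>d. diag (\<lambda>_. 1) i j *s B k i) = (\<Sum>i\<le>d. if i = j then B k i else 0)" for j
      by (intro sum.cong) (auto simp: diag_def)
    ultimately show ?thesis by (simp add: is_transition_matrix_def)
  qed
  show ?thesis
    unfolding is_transition_matrix_def
    by (intro conjI ballI bases card_eq identity[unfolded is_transition_matrix_def]
      T12 T13 T14 T15 T16 T21 T23 T24 T25 T26 T31 T32 T34 T35 T36 T41 T42 T43 T45 T46 T51 T52 T53 T54 T56 T61 T62 T63 T64 T65)
qed

end
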